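(* Let $f:U\to V$ be a polynomial-like map of topological degree $d_t>1$, let $\mu$ be its equilibrium measure and $J$ the Jacobian of $f$ with respect to the standard volume form on $\mathbb{C}^k$. Then $\langle\mu,\log J\rangle\geq\log d_t$. In particular, $\mu$ has no mass on the critical set of $f$.
   Context: A polynomial-like map is a proper holomorphic map $f:U\to V$ with $V\subset\mathbb{C}^k$ convex open and $U\Subset V$ open; its topological degree $d_t$ is the number of points in a generic fiber. Its equilibrium measure $\mu$ is the probability measure which is the limit of $d_t^{-n}(f^n)^*(\nu)$ for any probability measure $\nu$ on $V$ given by an $L^1$ form (independent of $\nu$), where $\langle f^*\nu,\varphi\rangle:=\langle\nu,\sum_{w\in f^{-1}(\cdot)}\varphi(w)\rangle$. The Jacobian $J$ is defined by $f^*(\Omega)=J\,\Omega$ for the standard volume form $\Omega$ on $\mathbb{C}^k$, i.e. $J=|\det Df|^2$. *)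

theory Defs
  imports "HOL-Analysis.Analysis" "HOL-Probability.Probability"
begin

definition cholomorphic_on :: "(complex^'k \<Rightarrow> complex^'k) \<Rightarrow> (complex^'k) set \<Rightarrow> bool" where
  "cholomorphic_on f U \<longleftrightarrow>
     (\<forall>x\<in>U. \<exists>L. (f has_derivative L) (at x) \<and> (\<forall>c v. L (c *s v) = c *s L v))"

definition cjac_matrix :: "(complex^'k \<Rightarrow> complex^'k) \<Rightarrow> complex^'k \<Rightarrow> complex^'k^'k" where
  "cjac_matrix f x = (\<chi> i j. (frechet_derivative f (at x) (axis j 1)) $ i)"

text \<open>Jacobian w.r.t. the standard volume form: J = |det Df|^2.\<close>
definition jacobian :: "(complex^'k \<Rightarrow> complex^'k) \<Rightarrow> complex^'k \<Rightarrow> real" where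
  "jacobian f x = (cmod (det (cjac_matrix f x)))^2"

text \<open>Polynomial-like map f : U \<rightarrow> V (only the values on U matter).\<close>
definition polynomial_like :: "(complex^'k \<Rightarrow> complex^'k) \<Rightarrow> (complex^'k) set \<Rightarrow> (complex^'k) set \<Rightarrow> bool" where
  "polynomial_like f U V \<longleftrightarrow>
     open U \<and> open V \<and> convex V \<and> compact (closure U) \<and> closure U \<subseteq> V \<and>
     cholomorphic_on f U \<and> continuous_on U f \<and> f ` U \<subseteq> V \<and>
     (\<forall>K. compact K \<and> K \<subseteq> V \<longrightarrow> compact {x\<in>U. f x \<in> K})"

definition topological_degree_is :: "(complex^'k \<Rightarrow> complex^'k) \<Rightarrow> (complex^'k) set \<Rightarrow> (complex^'k) set \<Rightarrow> nat \<Rightarrow> bool" where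
  "topological_degree_is f U V d \<longleftrightarrow>
     (AE y in lborel. y \<in> V \<longrightarrow> finite {x\<in>U. f x = y} \<and> card {x\<in>U. f x = y} = d)"

text \<open>Preimages of y under the n-th iterate f^n, defined on f^{-n}(V).\<close>
definition iter_preimage :: "(complex^'k \<Rightarrow> complex^'k) \<Rightarrow> (complex^'k) set \<Rightarrow> nat \<Rightarrow> complex^'k \<Rightarrow> (complex^'k) set" where
  "iter_preimage f U n y = {w. (\<forall>j<n. (f ^^ j) w \<in> U) \<and> (f ^^ n) w = y}"

text \<open>Equilibrium measure: a Borel probability measure on V such that for every
  probability measure \<nu> = g \<cdot> Leb with g an L^1 density supported in V, and every
  continuous compactly supported test function \<phi> on V,
  d^{-n} \<langle>(f^n)^* \<nu>, \<phi>\<rangle> = d^{-n} \<langle>\<nu>, \<Sum>_{w \<in> f^{-n}(.)} \<phi>(w)\<rangle> \<rightarrow> \<langle>\<mu>, \<phi>\<rangle>.\<close>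
definition equilibrium_measure :: "(complex^'k \<Rightarrow> complex^'k) \<Rightarrow> (complex^'k) set \<Rightarrow> (complex^'k) set \<Rightarrow> nat \<Rightarrow> (complex^'k) measure \<Rightarrow> bool" where
  "equilibrium_measure f U V d \<mu> \<longleftrightarrow>
     prob_space \<mu> \<and> sets \<mu> = sets borel \<and> emeasure \<mu> (UNIV - V) = 0 \<and>
     (\<forall>g \<phi>. (\<forall>y. g y \<ge> 0) \<and> (\<forall>y. y \<notin> V \<longrightarrow> g y = 0) \<and> integrable lborel g \<and>
            integral\<^sup>L lborel g = 1 \<and>
            continuous_on UNIV \<phi> \<and> compact (closure {x. \<phi> x \<noteq> 0}) \<and> closure {x. \<phi> x \<noteq> 0} \<subseteq> V
        \<longrightarrow> (\<lambda>n. (\<integral>y. g y * (\<Sum>w\<in>iter_preimage f U n y. \<phi> w) \<partial>lborel) / real d ^ n)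
              \<longlonglongrightarrow> (\<integral>x. \<phi> x \<partial>\<mu>))"

end

theory Submission
  imports Defs "HOL-Complex_Analysis.Cauchy_Integral_Formula"
begin

text \<open>
  Let \<open>\<nu>\<close> be normalised Lebesgue measure on the closure of \<open>U\<close>, let \<open>\<nu>\<^sub>n\<close> be its normalised pull-back
  under \<open>f\<^sup>n\<close>, and let \<open>F\<close> be a bounded continuous function with \<open>J \<le> exp F\<close> on the compact set
  \<open>core\<close> of points of \<open>U\<close> mapped into the closure of \<open>U\<close>, which carries all \<open>\<nu>\<^sub>n\<close> with \<open>n \<ge> 1\<close>.
  The Birkhoff sum \<open>S\<^sub>n\<close> of \<open>F\<close> satisfies \<open>\<integral> exp (- S\<^sub>n) d\<nu>\<^sub>n \<le> d\<^sup>-\<^sup>n\<close>, because the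
  change of variables inequality \<open>\<integral> \<Sum>\<^bsub>f w = y\<^esub> h(w) dy \<le> \<integral> h J\<close> can be iterated. By convexity
  \<open>\<integral> S\<^sub>n d\<nu>\<^sub>n \<ge> n log d\<close>, and invariance turns the left-hand side into \<open>\<Sum>\<^bsub>1 \<le> j \<le> n\<^esub> \<integral> F d\<nu>\<^sub>j\<close>.
  As \<open>\<nu>\<^sub>j\<close> tends to \<open>\<mu>\<close>, taking averages gives \<open>\<integral> F d\<mu> \<ge> log d\<close>. Now let \<open>F\<close> decrease to \<open>log J\<close>
  through the extensions of \<open>log (max J exp(-M))\<close> and use monotone convergence.
\<close>

section \<open>Coordinates on a Euclidean space\<close>

text \<open>\<open>F\<close> stands in for \<open>log J\<close> because convergence to \<mu> is
  given only against continuous functions with compact support in \<open>V\<close>, while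
  \<open>log J\<close> is minus infinity on the critical set. The argument tolerates any majorant:
  all it asks of a weight is \<open>exp (- F) * J \<le> 1\<close>, so that the area inequality, the
  upper half of the change of variables formula, makes each weighted pull-back step a contraction in
  \<open>L^1\<close>. Three obstacles shape the rest. Volume is governed by the real determinant of
  the derivative, whereas \<open>J\<close> is the squared modulus of a complex one; these are
  matched by factoring matrices. The degree is prescribed only for almost every fibre, but iteration
  visits fibres over all backward orbits; so every point with a defective fibre somewhere behind it
  is discarded, and these points form a null set because differentiable maps preserve null sets.
  Finally, test functions must vanish outside a compact part of \<open>V\<close>; a cutoff equal to
  1 on \<open>core\<close> repairs this, at the price of starting the averages at level 1.\<close>

definition of_coords :: "('n::finite \<Rightarrow> 'a::euclidean_space) \<Rightarrow> real^'n \<Rightarrow> 'a" where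
  "of_coords \<beta> x = (\<Sum>i\<in>UNIV. x $ i *\<^sub>R \<beta> i)"

definition to_coords :: "('n::finite \<Rightarrow> 'a::euclidean_space) \<Rightarrow> 'a \<Rightarrow> real^'n" where
  "to_coords \<beta> v = (\<chi> i. v \<bullet> \<beta> i)"

text \<open>The modulus of the determinant of a real endomorphism, read in orthonormal coordinates.
  The index type stays open, as it is later instantiated by one with \<open>2 * CARD('k)\<close>
  elements.\<close>

definition abs_det :: "('n::finite \<Rightarrow> 'a::euclidean_space) \<Rightarrow> ('a \<Rightarrow> 'a) \<Rightarrow> real" where
  "abs_det \<beta> L = \<bar>det (matrix (to_coords \<beta> \<circ> L \<circ> of_coords \<beta>))\<bar>"

lemma linear_of_coords: "linear (of_coords \<beta>)"
  unfolding of_coords_def by (intro linearI) (simp_all add: scaleR_add_left sum.distrib scaleR_sum_right)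

lemma linear_to_coords: "linear (to_coords \<beta>)"
  unfolding to_coords_def by (intro linearI) (simp_all add: vec_eq_iff inner_add_left)

context
  fixes \<beta> :: "'n::finite \<Rightarrow> 'a::euclidean_space"
  assumes \<beta>: "bij_betw \<beta> UNIV Basis"
begin

lemma inner_basis_enum: "\<beta> i \<bullet> \<beta> j = (if i = j then 1 else 0)"
proof -
  have "\<beta> i \<in> Basis" "\<beta> j \<in> Basis" "\<beta> i = \<beta> j \<longleftrightarrow> i = j"
    using \<beta> by (auto simp: bij_betw_def inj_on_def)
  then show ?thesis by (simp add: inner_Basis)
qed

lemma inner_of_coords: "of_coords \<beta> x \<bullet> \<beta> j = x $ j"
  by (simp add: of_coords_def inner_sum_left inner_basis_enum if_distrib cong: if_cong)

lemma to_of_coords [simp]: "to_coords \<beta> (of_coords \<beta> x) = x"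
  by (simp add: to_coords_def inner_of_coords vec_eq_iff)

lemma of_to_coords [simp]: "of_coords \<beta> (to_coords \<beta> v) = v"
proof -
  have "of_coords \<beta> (to_coords \<beta> v) = (\<Sum>b\<in>Basis. (v \<bullet> b) *\<^sub>R b)"
    unfolding of_coords_def to_coords_def using sum.reindex_bij_betw[OF \<beta>, of "\<lambda>b. (v \<bullet> b) *\<^sub>R b"] by simp
  then show ?thesis by (simp add: euclidean_representation)
qed

lemma inner_of_coords_of_coords: "of_coords \<beta> x \<bullet> of_coords \<beta> y = x \<bullet> y"
proof -
  have "of_coords \<beta> x \<bullet> of_coords \<beta> y = (\<Sum>i\<in>UNIV. y $ i * (of_coords \<beta> x \<bullet> \<beta> i))"
    by (subst (2) of_coords_def) (simp add: inner_sum_right)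
  also have "\<dots> = x \<bullet> y" by (simp add: inner_of_coords inner_vec_def mult.commute)
  finally show ?thesis .
qed

lemma norm_of_coords: "norm (of_coords \<beta> x) = norm x"
  by (simp add: norm_eq_sqrt_inner inner_of_coords_of_coords)

lemma norm_to_coords: "norm (to_coords \<beta> v) = norm v"
  using norm_of_coords[of "to_coords \<beta> v"] by simp

lemma abs_det_compose:
  assumes "linear L" "linear L'"
  shows "abs_det \<beta> (L \<circ> L') = abs_det \<beta> L * abs_det \<beta> L'"
proof -
  have "to_coords \<beta> \<circ> (L \<circ> L') \<circ> of_coords \<beta>
      = (to_coords \<beta> \<circ> L \<circ> of_coords \<beta>) \<circ> (to_coords \<beta> \<circ> L' \<circ> of_coords \<beta>)"
    by (simp add: fun_eq_iff)
  then show ?thesis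
    unfolding abs_det_def
    by (simp add: matrix_compose linear_compose assms linear_of_coords linear_to_coords det_mul abs_mult del: o_apply)
qed

lemma abs_det_isometry:
  assumes "linear L" "\<And>v. norm (L v) = norm v"
  shows "abs_det \<beta> L = 1"
proof -
  have "orthogonal_transformation (to_coords \<beta> \<circ> L \<circ> of_coords \<beta>)"
    unfolding orthogonal_transformation
    by (simp add: linear_compose assms linear_of_coords linear_to_coords norm_of_coords norm_to_coords)
  then have "orthogonal_matrix (matrix (to_coords \<beta> \<circ> L \<circ> of_coords \<beta>))"
    by (simp add: orthogonal_transformation_matrix)
  then show ?thesis
    unfolding abs_det_def using det_orthogonal_matrix by fastforce
qed

lemma abs_det_diagonal:
  assumes "\<And>b. b \<in> Basis \<Longrightarrow> L b = \<rho> b *\<^sub>R b"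
  shows "abs_det \<beta> L = \<bar>\<Prod>b\<in>Basis. \<rho> b\<bar>"
proof -
  have B: "\<beta> i \<in> Basis" for i using \<beta> by (auto simp: bij_betw_def)
  have ax: "of_coords \<beta> (axis i 1) = \<beta> i" for i
    by (simp add: of_coords_def axis_def if_distrib if_distribR cong: if_cong)
  have M: "matrix (to_coords \<beta> \<circ> L \<circ> of_coords \<beta>) $ i $ j = (if i = j then \<rho> (\<beta> i) else 0)" for i j
    by (simp add: matrix_def ax assms B to_coords_def inner_basis_enum)
  have "det (matrix (to_coords \<beta> \<circ> L \<circ> of_coords \<beta>)) = (\<Prod>i\<in>UNIV. \<rho> (\<beta> i))"
    by (subst det_diagonal) (simp_all add: M)
  also have "\<dots> = (\<Prod>b\<in>Basis. \<rho> b)"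
    using prod.reindex_bij_betw[OF \<beta>] by blast
  finally show ?thesis by (simp add: abs_det_def)
qed

text \<open>Relabelling coordinates along \<beta> pulls a box back to a box with the same side
  lengths, and \<open>lborel\<close> is characterised by its values on boxes.\<close>

lemma lborel_of_coords: "distr lborel borel (of_coords \<beta>) = lborel"
proof (rule lborel_eqI[symmetric])
  have [measurable]: "of_coords \<beta> \<in> borel_measurable borel"
    by (intro borel_measurable_continuous_onI linear_continuous_on)
       (simp add: linear_of_coords linear_linear)
  fix l u :: 'a assume lu: "\<And>b. b \<in> Basis \<Longrightarrow> l \<bullet> b \<le> u \<bullet> b"
  have B: "\<beta> i \<in> Basis" for i using \<beta> by (auto simp: bij_betw_def)
  have bas: "(\<forall>b\<in>Basis. P b) \<longleftrightarrow> (\<forall>i. P (\<beta> i))" for P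
    using \<beta> by (auto simp: bij_betw_def) (metis imageE)
  have eq: "of_coords \<beta> -` box l u = box (to_coords \<beta> l) (to_coords \<beta> u)"
    by (auto simp: box_def bas inner_of_coords Basis_vec_def inner_axis to_coords_def)
  have "(\<Prod>b\<in>(Basis::(real^'n) set). (to_coords \<beta> u - to_coords \<beta> l) \<bullet> b) = (\<Prod>i\<in>UNIV. (u - l) \<bullet> \<beta> i)"
  proof -
    have B: "(Basis::(real^'n) set) = (\<lambda>i. axis i 1) ` UNIV" by (auto simp: Basis_vec_def)
    have "inj (\<lambda>i::'n. axis i (1::real))" by (simp add: inj_on_def axis_eq_axis)
    then have "prod h (Basis::(real^'n) set) = (\<Prod>i\<in>UNIV. h (axis i 1))" for h :: "_ \<Rightarrow> real"
      unfolding B by (subst prod.reindex) auto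
    then show ?thesis
      by (simp add: inner_axis to_coords_def inner_diff_left)
  qed
  also have "\<dots> = (\<Prod>b\<in>Basis. (u - l) \<bullet> b)"
    using prod.reindex_bij_betw[OF \<beta>, of "\<lambda>b. (u - l) \<bullet> b"] by simp
  finally have pr: "(\<Prod>b\<in>(Basis::(real^'n) set). (to_coords \<beta> u - to_coords \<beta> l) \<bullet> b) = (\<Prod>b\<in>Basis. (u - l) \<bullet> b)" .
  have le: "\<And>b. b \<in> Basis \<Longrightarrow> to_coords \<beta> l \<bullet> b \<le> to_coords \<beta> u \<bullet> b"
    using lu B by (auto simp: Basis_vec_def inner_axis to_coords_def)
  show "emeasure (distr lborel borel (of_coords \<beta>)) (box l u) = ennreal (\<Prod>b\<in>Basis. (u - l) \<bullet> b)"
    by (simp add: emeasure_distr eq emeasure_lborel_box[OF le] pr)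
qed simp

lemma measurable_of_coords: "of_coords \<beta> \<in> lebesgue \<rightarrow>\<^sub>M lebesgue"
  and lebesgue_of_coords: "distr lebesgue lebesgue (of_coords \<beta>) = lebesgue"
proof -
  have [measurable]: "of_coords \<beta> \<in> borel_measurable borel"
    by (intro borel_measurable_continuous_onI linear_continuous_on)
       (simp add: linear_of_coords linear_linear)
  have m: "of_coords \<beta> \<in> lebesgue \<rightarrow>\<^sub>M lborel" by (rule measurable_completion) simp
  have d: "distr lebesgue lborel (of_coords \<beta>) = lborel"
    by (subst distr_completion) (auto simp: lborel_of_coords cong: distr_cong)
  show "of_coords \<beta> \<in> lebesgue \<rightarrow>\<^sub>M lebesgue"
    by (intro completion.measurable_completion2[OF m]) (simp add: d)
  show "distr lebesgue lebesgue (of_coords \<beta>) = lebesgue"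
    using completion.completion_distr_eq[OF m] by (simp add: d)
qed

end

section \<open>The real determinant of a complex linear map\<close>

lemma linear_matrix_vector_mult_complex: "linear ((*v) (A :: complex^'n^'m))"
  by (intro linearI)
     (simp_all add: matrix_vector_mult_def vec_eq_iff sum.distrib algebra_simps scaleR_sum_right)

lemma matrix_vector_mult_compose: "(*v) (A ** B) = (*v) A \<circ> (*v) (B :: 'a::comm_semiring_1^'n^'m)"
  by (simp add: fun_eq_iff matrix_vector_mul_assoc)

definition scale_coord :: "'k \<Rightarrow> complex \<Rightarrow> complex^'k^'k" where
  "scale_coord k c = (\<chi> i j. if i = j then (if i = k then c else 1) else 0)"

lemma scale_coord_mult: "scale_coord k c *v v = (\<chi> i. (if i = k then c else 1) * v $ i)"
proof -
  have "(\<Sum>j\<in>UNIV. scale_coord k c $ i $ j * v $ j) = (\<Sum>j\<in>UNIV. if j = i then (if i = k then c else 1) * v $ i else 0)" for i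
    by (intro sum.cong) (auto simp: scale_coord_def)
  then show ?thesis by (simp add: matrix_vector_mult_def)
qed

text \<open>Left multiplication by this matrix replaces row \<open>k\<close> by the combination of
  all rows with coefficients \<open>b\<close>. These are the elementary factors into which an
  invertible matrix is decomposed below.\<close>

definition unit_row :: "'k \<Rightarrow> complex^'k \<Rightarrow> complex^'k^'k" where
  "unit_row k b = (\<chi> i. if i = k then b else axis i 1)"

lemma unit_row_mult:
  "unit_row k b *v v = (\<chi> i. if i = k then (\<Sum>j\<in>UNIV. b $ j * v $ j) else v $ i)"
proof -
  have "(\<Sum>j\<in>UNIV. unit_row k b $ i $ j * v $ j) = (\<Sum>j\<in>UNIV. if j = i then v $ i else 0)" if "i \<noteq> k" for i
    using that by (intro sum.cong) (auto simp: unit_row_def axis_def)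
  moreover have "unit_row k b $ k = b" by (simp add: unit_row_def)
  ultimately show ?thesis by (auto simp: matrix_vector_mult_def vec_eq_iff)
qed

context
  fixes \<beta> :: "'n::finite \<Rightarrow> complex^'k"
  assumes \<beta>: "bij_betw \<beta> UNIV Basis"
begin

lemma abs_det_matrix_mult:
  "abs_det \<beta> ((*v) (A ** B)) = abs_det \<beta> ((*v) A) * abs_det \<beta> ((*v) B)"
  by (simp add: matrix_vector_mult_compose abs_det_compose[OF \<beta>] linear_matrix_vector_mult_complex)

text \<open>A real factor acts on both real directions \<open>axis k 1\<close> and
  \<open>axis k \<i>\<close> of the complex coordinate \<open>k\<close>, whence the square.\<close>

lemma abs_det_scale_coord_real:
  fixes r :: real assumes "r \<ge> 0"
  shows "abs_det \<beta> ((*v) (scale_coord k (of_real r))) = r\<^sup>2"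
proof -
  define \<rho> :: "complex^'k \<Rightarrow> real" where "\<rho> b = (if b = axis k 1 \<or> b = axis k \<i> then r else 1)" for b
  have "scale_coord k (of_real r) *v b = \<rho> b *\<^sub>R b" if b: "b \<in> Basis" for b :: "complex^'k"
  proof -
    obtain i where "b = axis i 1 \<or> b = axis i \<i>"
      using b unfolding Basis_vec_def Basis_complex_def by blast
    moreover have "axis i 1 \<noteq> axis k \<i>" "axis i \<i> \<noteq> axis k (1::complex)"
      by (auto simp: axis_eq_axis complex_eq_iff)
    ultimately have "\<rho> b = (if i = k then r else 1)" and "\<exists>z. b = axis i z"
      by (auto simp: \<rho>_def axis_eq_axis)
    then show ?thesis
      by (auto simp: scale_coord_mult vec_eq_iff scaleR_complex.ctr complex_eq_iff axis_def)
  qed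
  then have "abs_det \<beta> ((*v) (scale_coord k (of_real r))) = \<bar>\<Prod>b\<in>Basis. \<rho> b\<bar>"
    by (rule abs_det_diagonal[OF \<beta>])
  also have "(\<Prod>b\<in>Basis. \<rho> b) = (\<Prod>b\<in>{axis k 1, axis k \<i>}. \<rho> b)"
    by (rule prod.mono_neutral_right) (auto simp: \<rho>_def Basis_vec_def Basis_complex_def)
  also have "\<dots> = r\<^sup>2" by (simp add: \<rho>_def axis_eq_axis power2_eq_square complex_eq_iff)
  finally show ?thesis by simp
qed

lemma abs_det_scale_coord: "abs_det \<beta> ((*v) (scale_coord k c)) = (cmod c)\<^sup>2"
proof -
  \<comment> \<open>Polar decomposition of \<open>c\<close>. The value 1 at \<open>c = 0\<close>
    keeps \<open>u\<close> of modulus 1, so that scaling by \<open>u\<close> is always an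
    isometry.\<close>
  define u where "u = (if c = 0 then 1 else sgn c)"
  have u: "cmod u = 1" "of_real (cmod c) * u = c"
    by (simp add: u_def norm_sgn) (simp add: u_def sgn_eq)
  have "abs_det \<beta> ((*v) (scale_coord k u)) = 1"
    by (rule abs_det_isometry[OF \<beta>])
       (auto simp: linear_matrix_vector_mult_complex scale_coord_mult norm_vec_def L2_set_def norm_mult u
             intro!: sum.cong)
  moreover have "scale_coord k c = scale_coord k (of_real (cmod c)) ** scale_coord k u"
    unfolding matrix_eq matrix_vector_mul_assoc[symmetric]
    using u(2) by (simp add: scale_coord_mult vec_eq_iff mult.assoc[symmetric])
  ultimately show ?thesis
    by (simp add: abs_det_matrix_mult abs_det_scale_coord_real)
qed

text \<open>A transvection is conjugate to its own square by a diagonal matrix, and it is invertible.\<close>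

lemma abs_det_unit_row_unipotent:
  assumes "b $ k = 1"
  shows "abs_det \<beta> ((*v) (unit_row k b)) = 1"
proof -
  define b' where "b' = (\<chi> j. if j = k then 1 else - b $ j)"
  let ?D = "\<lambda>A. abs_det \<beta> ((*v) A)"
  have split: "(\<Sum>j\<in>UNIV. h j) = h k + (\<Sum>j\<in>UNIV-{k}. h j)" for h :: "'k \<Rightarrow> complex"
    by (simp add: sum.remove)
  have "unit_row k b ** unit_row k b = scale_coord k 2 ** unit_row k b ** scale_coord k (1/2)"
    unfolding matrix_eq matrix_vector_mul_assoc[symmetric]
    using assms by (auto simp: unit_row_mult scale_coord_mult vec_eq_iff split algebra_simps sum_distrib_left)
  then have "?D (unit_row k b) * ?D (unit_row k b) = ?D (scale_coord k 2) * ?D (unit_row k b) * ?D (scale_coord k (1/2))"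
    by (metis abs_det_matrix_mult)
  then have "?D (unit_row k b) * ?D (unit_row k b) = ?D (unit_row k b)"
    by (simp add: abs_det_scale_coord power2_eq_square)
  moreover have "?D (unit_row k b) \<noteq> 0"
  proof -
    have "unit_row k b' ** unit_row k b = mat 1"
      unfolding matrix_eq matrix_vector_mul_assoc[symmetric]
      using assms by (auto simp: unit_row_mult b'_def vec_eq_iff split sum_negf)
    moreover have "?D (mat 1) = 1"
      by (rule abs_det_isometry[OF \<beta>]) (auto simp: linear_matrix_vector_mult_complex)
    ultimately have "?D (unit_row k b') * ?D (unit_row k b) = 1"
      by (metis abs_det_matrix_mult)
    then show ?thesis by auto
  qed
  ultimately show ?thesis by simp
qed

lemma det_unit_row: "det (unit_row k b) = b $ k"
proof -
  have "unit_row k b = (\<chi> i. if i = k then (\<Sum>j\<in>UNIV. b $ j *s axis j 1) else axis i 1)"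
    unfolding basis_expansion by (simp add: unit_row_def)
  then have "det (unit_row k b) = (\<Sum>j\<in>UNIV. b $ j * det (\<chi> i. if i = k then axis j 1 else axis i (1::complex)))"
    by (simp only: det_linear_row_sum[OF finite] det_row_mul)
  also have "\<dots> = (\<Sum>j\<in>UNIV. if j = k then b $ k else 0)"
  proof (intro sum.cong refl)
    fix j
    let ?A = "\<chi> i. if i = k then axis j 1 else axis i (1::complex)"
    show "b $ j * det ?A = (if j = k then b $ k else 0)"
    proof (cases "j = k")
      case True
      then have "?A = mat 1" by (simp add: vec_eq_iff mat_def axis_def)
      then show ?thesis using True by simp
    next
      case False
      then have "det ?A = 0"
        by (intro det_identical_rows[of j k]) (auto simp: row_def vec_eq_iff)
      then show ?thesis using False by simp
    qed
  qed
  finally show ?thesis by simp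
qed

lemma abs_det_unit_row:
  assumes "b $ k \<noteq> 0"
  shows "abs_det \<beta> ((*v) (unit_row k b)) = (cmod (b $ k))\<^sup>2"
proof -
  have *: "unit_row k b = scale_coord k (b $ k) ** unit_row k ((1 / b $ k) *s b)"
    unfolding matrix_eq matrix_vector_mul_assoc[symmetric]
    using assms by (simp add: unit_row_mult scale_coord_mult vec_eq_iff sum_distrib_left)
  show ?thesis
    using assms by (subst *) (simp add: abs_det_matrix_mult abs_det_scale_coord abs_det_unit_row_unipotent)
qed

text \<open>Induction on the number of rows that are not standard unit vectors. If there are none,
  \<open>A\<close> permutes the coordinates and is an isometry. Otherwise expand
  \<open>det A\<close> linearly in such a row \<open>k\<close>: some term is nonzero, so row
  \<open>k\<close> can be replaced by a unit vector with the matrix remaining invertible. The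
  original matrix is recovered by a factor \<open>unit_row k b\<close>, on which both sides are
  known.\<close>

lemma abs_det_eq_cmod_det_invertible:
  assumes "det A \<noteq> 0"
  shows "abs_det \<beta> ((*v) A) = (cmod (det A))\<^sup>2"
  using assms
proof (induction A rule: measure_induct_rule[where f = "\<lambda>A. card {i. A $ i \<notin> range (\<lambda>m. axis m (1::complex))}"])
  case (less A)
  show ?case
  proof (cases "\<exists>k. A $ k \<notin> range (\<lambda>m. axis m 1)")
    case False
    then have "\<forall>i. \<exists>m. A $ i = axis m 1" by blast
    then obtain \<sigma> where \<sigma>: "\<And>i. A $ i = axis (\<sigma> i) 1"
      using choice[of "\<lambda>i m. A $ i = axis m 1"] by blast
    have "inj \<sigma>"
    proof (rule injI, rule ccontr)
      fix i j assume "\<sigma> i = \<sigma> j" "i \<noteq> j"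
      then have "det A = 0" by (intro det_identical_rows[of i j]) (auto simp: row_def vec_eq_iff \<sigma>)
      with less.prems show False by simp
    qed
    then have bij: "bij \<sigma>" by (simp add: finite_UNIV_inj_surj bij_def)
    then have perm: "\<sigma> permutes UNIV" by (auto intro: bij_imp_permutes)
    have "A = (\<chi> i. mat 1 $ \<sigma> i)"
      by (auto simp: vec_eq_iff \<sigma> mat_def axis_def)
    then have "det A = of_int (sign \<sigma>)"
      using det_permute_rows[OF perm, of "mat 1 :: complex^'k^'k"] by simp
    then have "cmod (det A) = 1" by (simp add: sign_def)
    moreover have "A *v v = (\<chi> i. v $ \<sigma> i)" for v
      by (auto simp: vec_eq_iff matrix_vector_mult_def \<sigma> axis_def if_distrib if_distribR cong: if_cong)
    then have "norm (A *v v) = norm v" for v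
      using sum.reindex_bij_betw[OF bij, of "\<lambda>i. (norm (v $ i))\<^sup>2"]
      by (simp add: norm_vec_def L2_set_def)
    then have "abs_det \<beta> ((*v) A) = 1"
      by (intro abs_det_isometry[OF \<beta>] linear_matrix_vector_mult_complex)
    ultimately show ?thesis by simp
  next
    case True
    then obtain k where k: "A $ k \<notin> range (\<lambda>m. axis m 1)" by blast
    define C where "C m = (\<chi> i. if i = k then axis m 1 else A $ i)" for m
    have "A = (\<chi> i. if i = k then (\<Sum>m\<in>UNIV. A $ k $ m *s axis m 1) else A $ i)"
      unfolding basis_expansion by (simp add: vec_eq_iff)
    then have "det A = det (\<chi> i. if i = k then (\<Sum>m\<in>UNIV. A $ k $ m *s axis m 1) else A $ i)"
      by (rule arg_cong)
    also have "\<dots> = (\<Sum>m\<in>UNIV. A $ k $ m * det (C m))"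
      unfolding C_def by (simp only: det_linear_row_sum[OF finite] det_row_mul)
    finally have "det A = (\<Sum>m\<in>UNIV. A $ k $ m * det (C m))" .
    with less.prems obtain m where m: "det (C m) \<noteq> 0"
      by (metis (no_types, lifting) mult_zero_right sum.neutral)
    have "{i. C m $ i \<notin> range (\<lambda>m. axis m 1)} \<subset> {i. A $ i \<notin> range (\<lambda>m. axis m 1)}"
      using k by (auto simp: C_def split: if_splits)
    then have "card {i. C m $ i \<notin> range (\<lambda>m. axis m 1)} < card {i. A $ i \<notin> range (\<lambda>m. axis m 1)}"
      by (intro psubset_card_mono) auto
    from less.IH[OF this m] have IH: "abs_det \<beta> ((*v) (C m)) = (cmod (det (C m)))\<^sup>2" .
    obtain C' where C': "C' ** C m = mat 1"
      using m by (metis invertible_det_nz invertible_def)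
    \<comment> \<open>The coordinates of row \<open>k\<close> of \<open>A\<close> in the basis
      formed by the rows of \<open>C m\<close>.\<close>
    define b where "b = A $ k v* C'"
    have bC: "b v* C m = A $ k"
      by (simp add: b_def vector_matrix_mul_assoc C')
    have "(unit_row k b ** C m) $ i $ j = A $ i $ j" for i j
    proof (cases "i = k")
      case True
      then show ?thesis
        unfolding True bC[symmetric] by (simp add: unit_row_def matrix_matrix_mult_def vector_matrix_mult_def)
    next
      case False
      have "(\<Sum>l\<in>UNIV. (if l = i then 1 else 0) * C m $ l $ j) = (\<Sum>l\<in>UNIV. if l = i then C m $ l $ j else 0)"
        by (intro sum.cong) auto
      then show ?thesis
        using False by (simp add: C_def matrix_matrix_mult_def unit_row_def axis_def)
    qed
    then have A: "A = unit_row k b ** C m" by (simp add: vec_eq_iff)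
    then have det_A: "det A = b $ k * det (C m)"
      by (simp add: det_mul det_unit_row)
    with less.prems have "b $ k \<noteq> 0" by auto
    then have "abs_det \<beta> ((*v) A) = (cmod (b $ k))\<^sup>2 * (cmod (det (C m)))\<^sup>2"
      unfolding A abs_det_matrix_mult IH by (simp add: abs_det_unit_row)
    then show ?thesis
      by (simp add: det_A norm_mult power_mult_distrib)
  qed
qed

theorem abs_det_eq_cmod_det: "abs_det \<beta> ((*v) A) = (cmod (det A))\<^sup>2"
proof (cases "det A = 0")
  case True
  \<comment> \<open>A complex kernel vector, written in real coordinates, is a nonzero real kernel
    vector, so both determinants vanish together.\<close>
  then have "\<not> (\<exists>B. B ** A = mat 1)"
    using invertible_det_nz[of A] invertible_left_inverse[of A] by simp
  then obtain v where v: "v \<noteq> 0" "A *v v = 0"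
    unfolding matrix_left_invertible_ker by blast
  let ?M = "matrix (to_coords \<beta> \<circ> (*v) A \<circ> of_coords \<beta>)"
  have lin: "linear (to_coords \<beta> \<circ> (*v) A \<circ> of_coords \<beta>)"
    by (intro linear_compose linear_of_coords linear_to_coords linear_matrix_vector_mult_complex)
  have "?M *v to_coords \<beta> v = 0"
    unfolding fun_cong[OF matrix_vector_mul(2)[OF lin]]
    by (simp add: of_to_coords[OF \<beta>] v linear_0[OF linear_to_coords])
  moreover have "to_coords \<beta> v \<noteq> 0"
    using norm_to_coords[OF \<beta>, of v] v by auto
  ultimately have "\<not> (\<exists>B. B ** ?M = mat 1)"
    unfolding matrix_left_invertible_ker by blast
  then have "det ?M = 0"
    using invertible_det_nz[of ?M] invertible_left_inverse[of ?M] by simp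
  with True show ?thesis by (simp add: abs_det_def)
qed (rule abs_det_eq_cmod_det_invertible)

end

section \<open>Holomorphic maps of several variables\<close>

lemma cholomorphic_onD:
  assumes "cholomorphic_on f U" "x \<in> U"
  shows "(f has_derivative frechet_derivative f (at x)) (at x)"
    and "frechet_derivative f (at x) (c *s v) = c *s frechet_derivative f (at x) v"
    and "frechet_derivative f (at x) = (*v) (cjac_matrix f x)"
proof -
  obtain L where L: "(f has_derivative L) (at x)" "\<And>c v. L (c *s v) = c *s L v"
    using assms unfolding cholomorphic_on_def by blast
  have eq: "frechet_derivative f (at x) = L"
    using frechet_derivative_at[OF L(1)] by simp
  show "(f has_derivative frechet_derivative f (at x)) (at x)"
    and "frechet_derivative f (at x) (c *s v) = c *s frechet_derivative f (at x) v"
    using L by (simp_all add: eq)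
  have lin: "linear L" using L(1) has_derivative_linear by blast
  show "frechet_derivative f (at x) = (*v) (cjac_matrix f x)"
  proof
    fix v :: "complex^'a"
    have "L v = L (\<Sum>j\<in>UNIV. v $ j *s axis j 1)" unfolding basis_expansion ..
    also have "\<dots> = (\<Sum>j\<in>UNIV. v $ j *s L (axis j 1))"
      by (simp add: linear_sum[OF lin] L(2))
    finally show "frechet_derivative f (at x) v = cjac_matrix f x *v v"
      by (simp add: eq cjac_matrix_def vec_eq_iff matrix_vector_mult_def mult.commute)
  qed
qed

lemma cholomorphic_on_partial:
  assumes "cholomorphic_on f U" "x + axis j t \<in> U"
  shows "((\<lambda>t. f (x + axis j t) $ i) has_field_derivative cjac_matrix f (x + axis j t) $ i $ j) (at t)"
proof -
  let ?D = "frechet_derivative f (at (x + axis j t))"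
  have "linear (\<lambda>t::complex. axis j t)"
    by (intro linearI) (auto simp: vec_eq_iff axis_def)
  then have "((\<lambda>t. x + axis j t) has_derivative (\<lambda>h. axis j h)) (at t)"
    by (auto intro!: derivative_eq_intros bounded_linear_imp_has_derivative simp: linear_linear)
  from has_derivative_compose[OF this cholomorphic_onD(1)[OF assms]]
  have "((\<lambda>t. f (x + axis j t)) has_derivative (\<lambda>h. ?D (axis j h))) (at t)" .
  then have "((\<lambda>t. f (x + axis j t) $ i) has_derivative (\<lambda>h. ?D (axis j h) $ i)) (at t)"
    by (rule bounded_linear.has_derivative[OF bounded_linear_vec_nth])
  moreover have "?D (axis j h) $ i = cjac_matrix f (x + axis j t) $ i $ j * h" for h
  proof -
    have "axis j h = h *s axis j 1" by (simp add: vec_eq_iff axis_def)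
    then have "?D (axis j h) = h *s ?D (axis j 1)" by (metis cholomorphic_onD(2)[OF assms])
    then show ?thesis by (simp add: cjac_matrix_def)
  qed
  ultimately show ?thesis
    by (simp add: has_field_derivative_def)
qed

lemma norm_axis_complex: "norm (axis j t :: complex^'k) = cmod t"
proof -
  have "(\<Sum>i\<in>UNIV. (cmod (axis j t $ i))\<^sup>2) = (\<Sum>i\<in>UNIV. if i = j then (cmod t)\<^sup>2 else 0)"
    by (intro sum.cong) (auto simp: axis_def)
  then show ?thesis by (simp add: norm_vec_def L2_set_def)
qed

text \<open>Cauchy's inequality on discs in the direction \<open>axis j 1\<close>, applied to the difference of two slices.\<close>

lemma continuous_on_cjac_matrix:
  assumes hol: "cholomorphic_on f U" and "open U"
  shows "continuous_on U (\<lambda>x. cjac_matrix f x $ i $ j)"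
  unfolding continuous_on_iff
proof (intro ballI allI impI)
  fix x0 and e :: real assume x0: "x0 \<in> U" and e: "e > 0"
  obtain r0 where r0: "r0 > 0" "cball x0 r0 \<subseteq> U"
    using \<open>open U\<close> x0 open_contains_cball by blast
  \<comment> \<open>Half the radius: a disc of radius \<open>r\<close> about a point within
    \<open>r\<close> of \<open>x0\<close> stays in \<open>cball x0 r0\<close>.\<close>
  define r where "r = r0 / 2"
  have r: "r > 0" using r0 by (simp add: r_def)
  have contU: "continuous_on U f"
    using cholomorphic_onD(1)[OF hol] has_derivative_continuous continuous_at_imp_continuous_on by blast
  then have "uniformly_continuous_on (cball x0 r0) f"
    using r0 by (intro compact_uniformly_continuous) (auto intro: continuous_on_subset)
  \<comment> \<open>Cauchy's inequality divides the bound on the circle by its radius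
    \<open>r\<close>, which leaves \<open>e / 2\<close>.\<close>
  moreover have "e / 2 * r > 0" using e r by simp
  ultimately obtain \<delta> where \<delta>: "\<delta> > 0"
    "\<And>a b. a \<in> cball x0 r0 \<Longrightarrow> b \<in> cball x0 r0 \<Longrightarrow> dist b a < \<delta> \<Longrightarrow> dist (f b) (f a) < e / 2 * r"
    unfolding uniformly_continuous_on_def by metis
  have "dist (cjac_matrix f x $ i $ j) (cjac_matrix f x0 $ i $ j) < e" if x: "dist x x0 < min r \<delta>" for x
  proof -
    define h where "h t = f (x + axis j t) $ i - f (x0 + axis j t) $ i" for t
    have near: "x + axis j t \<in> cball x0 r0" "x0 + axis j t \<in> cball x0 r0" if "cmod t \<le> r" for t
    proof -
      have "norm (x0 - (x + axis j t)) \<le> norm (x0 - x) + norm (axis j t :: complex^'a)"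
        by (metis diff_diff_eq norm_triangle_ineq4)
      then show "x + axis j t \<in> cball x0 r0"
        using that x r by (simp add: dist_norm norm_axis_complex r_def norm_minus_commute)
      show "x0 + axis j t \<in> cball x0 r0"
        using that r by (simp add: dist_norm norm_axis_complex r_def)
    qed
    have der: "(h has_field_derivative
        cjac_matrix f (x + axis j t) $ i $ j - cjac_matrix f (x0 + axis j t) $ i $ j) (at t)" if "cmod t \<le> r" for t
      unfolding h_def using near[OF that] r0
      by (intro DERIV_diff cholomorphic_on_partial[OF hol]) auto
    have "cmod ((deriv ^^ 1) h 0) \<le> fact 1 * (e / 2 * r) / r ^ 1"
    proof (rule Cauchy_inequality)
      show "h holomorphic_on ball 0 r"
        by (intro holomorphic_onI) (metis der field_differentiable_at_within field_differentiable_def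
            less_imp_le mem_ball_0)
      show "continuous_on (cball 0 r) h"
        using der by (intro continuous_at_imp_continuous_on ballI) (auto dest: DERIV_isCont)
      show "cmod (h t) \<le> e / 2 * r" if "cmod (0 - t) = r" for t
      proof -
        have "dist (f (x + axis j t)) (f (x0 + axis j t)) < e / 2 * r"
          using near[of t] that x by (intro \<delta>) auto
        then show ?thesis
          using Finite_Cartesian_Product.norm_nth_le[of "f (x + axis j t) - f (x0 + axis j t)" i]
          by (simp add: h_def dist_norm)
      qed
    qed (use r in auto)
    moreover have "deriv h 0 = cjac_matrix f x $ i $ j - cjac_matrix f x0 $ i $ j"
    proof -
      have 0: "x + axis j 0 = x" for x :: "complex^'a" by (simp add: vec_eq_iff axis_def)
      show ?thesis using DERIV_imp_deriv[OF der[of 0]] r by (simp add: 0)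
    qed
    ultimately show ?thesis using r e by (simp add: dist_norm)
  qed
  then show "\<exists>d>0. \<forall>x\<in>U. dist x x0 < d \<longrightarrow> dist (cjac_matrix f x $ i $ j) (cjac_matrix f x0 $ i $ j) < e"
    using r \<delta>(1) by (intro exI[of _ "min r \<delta>"]) auto
qed

lemma continuous_on_jacobian:
  assumes "cholomorphic_on f U" "open U"
  shows "continuous_on U (jacobian f)"
  unfolding jacobian_def det_def
  by (intro continuous_intros continuous_on_cjac_matrix[OF assms])

lemma jacobian_nonneg: "jacobian f x \<ge> 0"
  by (simp add: jacobian_def)

section \<open>Measurability of the derivative of an arbitrary map\<close>

text \<open>The radius runs through a sequence instead of all positive reals, so that the points
  with this property form a countable union, which turns out to consist of closed sets.\<close>

definition approx_at :: "('a::real_normed_vector \<Rightarrow> 'b::real_normed_vector) \<Rightarrow> ('a \<Rightarrow> 'b) \<Rightarrow> real \<Rightarrow> 'a \<Rightarrow> bool" where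
  "approx_at f L c x \<longleftrightarrow> (\<exists>m::nat. \<forall>y\<in>ball x (1 / real (Suc m)). norm (f y - f x - L (y - x)) \<le> c * norm (y - x))"

lemma approx_atI:
  assumes "\<delta> > 0" "\<And>y. norm (y - x) < \<delta> \<Longrightarrow> norm (f y - f x - L (y - x)) \<le> c * norm (y - x)"
  shows "approx_at f L c x"
proof -
  obtain m where "1 / real (Suc m) < \<delta>" using nat_approx_posE[OF assms(1)] by blast
  then show ?thesis
    unfolding approx_at_def using assms(2)
    by (intro exI[of _ m]) (auto simp: dist_norm norm_minus_commute)
qed

lemma approx_atE:
  assumes "approx_at f L c x"
  obtains \<delta> where "\<delta> > 0" "\<And>y. norm (y - x) < \<delta> \<Longrightarrow> norm (f y - f x - L (y - x)) \<le> c * norm (y - x)"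
proof -
  obtain m where m: "\<forall>y\<in>ball x (1 / real (Suc m)). norm (f y - f x - L (y - x)) \<le> c * norm (y - x)"
    using assms unfolding approx_at_def by blast
  show ?thesis
    by (rule that[of "1 / real (Suc m)"]) (use m in \<open>auto simp: dist_norm norm_minus_commute\<close>)
qed

lemma has_derivative_iff_approx_at:
  "(f has_derivative A) (at x) \<longleftrightarrow> bounded_linear A \<and> (\<forall>e>0. approx_at f A e x)"
proof -
  have "approx_at f A e x \<longleftrightarrow> (\<exists>\<delta>>0. \<forall>y. norm (y - x) < \<delta> \<longrightarrow> norm (f y - f x - A (y - x)) \<le> e * norm (y - x))" for e
    by (auto intro: approx_atI elim!: approx_atE)
  then show ?thesis by (simp add: has_derivative_at_alt)
qed

text \<open>Subtracting the estimates for \<open>y\<close> and for the limit point itself, both centred at the terms of the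
  sequence, avoids continuity of \<open>f\<close>.\<close>

lemma closed_linear_approx:
  assumes "linear L" "\<delta> > 0"
  shows "closed {x. \<forall>y\<in>ball x \<delta>. norm (f y - f x - L (y - x)) \<le> c * norm (y - x)}" (is "closed ?E")
  unfolding closed_sequential_limits
proof (intro allI impI, elim conjE)
  fix X x assume X: "\<forall>n. X n \<in> ?E" and lim: "X \<longlonglongrightarrow> x"
  show "x \<in> ?E"
  proof (intro CollectI ballI)
    fix y assume y: "y \<in> ball x \<delta>"
    have "(\<lambda>n. dist (X n) z) \<longlonglongrightarrow> dist x z" for z by (intro tendsto_intros lim)
    then have ev: "eventually (\<lambda>n. dist (X n) z < \<delta>) sequentially" if "dist x z < \<delta>" for z
      using order_tendstoD(2) that by blast
    have ev_x: "eventually (\<lambda>n. dist (X n) x < \<delta>) sequentially"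
      and ev_y: "eventually (\<lambda>n. dist (X n) y < \<delta>) sequentially"
      using y assms(2) by (auto intro!: ev)
    have "eventually (\<lambda>n. norm (f y - f x - L (y - x)) \<le> c * norm (y - X n) + c * norm (x - X n)) sequentially"
      using ev_x ev_y
    proof eventually_elim
      case (elim n)
      then have 1: "norm (f x - f (X n) - L (x - X n)) \<le> c * norm (x - X n)"
        and 2: "norm (f y - f (X n) - L (y - X n)) \<le> c * norm (y - X n)"
        using X by auto
      have *: "f y - f x - L (y - x) = (f y - f (X n) - L (y - X n)) - (f x - f (X n) - L (x - X n))"
        by (simp add: linear_diff[OF assms(1)])
      have "norm (f y - f x - L (y - x)) \<le> norm (f y - f (X n) - L (y - X n)) + norm (f x - f (X n) - L (x - X n))"
        unfolding * by (rule norm_triangle_ineq4)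
      then show ?case using 1 2 by linarith
    qed
    moreover have "(\<lambda>n. c * norm (y - X n) + c * norm (x - X n)) \<longlonglongrightarrow> c * norm (y - x) + c * norm (x - x)"
      by (intro tendsto_intros lim)
    ultimately have "norm (f y - f x - L (y - x)) \<le> c * norm (y - x) + c * norm (x - x)"
      by (intro tendsto_lowerbound) auto
    then show "norm (f y - f x - L (y - x)) \<le> c * norm (y - x)" by simp
  qed
qed

lemma pred_approx_at:
  fixes f :: "'a::real_normed_vector \<Rightarrow> 'b::real_normed_vector"
  assumes "linear L"
  shows "Measurable.pred borel (approx_at f L c)"
proof -
  have "{x. approx_at f L c x}
    = (\<Union>m. {x. \<forall>y\<in>ball x (1 / real (Suc m)). norm (f y - f x - L (y - x)) \<le> c * norm (y - x)})"
    by (auto simp: approx_at_def)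
  also have "\<dots> \<in> sets borel"
    by (intro sets.countable_UN) (auto intro!: borel_closed closed_linear_approx[OF assms])
  finally show ?thesis by (simp add: pred_def)
qed

text \<open>Both maps approximate the same increment of \<open>f\<close> near \<open>x\<close>, so
  they are close on short vectors; homogeneity carries the bound to every \<open>h\<close>.\<close>

lemma approx_at_diff_le:
  assumes "linear L" "linear L'" "approx_at f L c x" "approx_at f L' c' x"
  shows "norm (L h - L' h) \<le> (c + c') * norm h"
proof (cases "h = 0")
  case True
  then show ?thesis using assms by (simp add: linear_0)
next
  case False
  obtain \<delta> where \<delta>: "\<delta> > 0" "\<And>y. norm (y - x) < \<delta> \<Longrightarrow> norm (f y - f x - L (y - x)) \<le> c * norm (y - x)"
    using approx_atE[OF assms(3)] by blast
  obtain \<delta>' where \<delta>': "\<delta>' > 0" "\<And>y. norm (y - x) < \<delta>' \<Longrightarrow> norm (f y - f x - L' (y - x)) \<le> c' * norm (y - x)"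
    using approx_atE[OF assms(4)] by blast
  define t where "t = min \<delta> \<delta>' / (2 * norm h)"
  have t: "t > 0" "norm (t *\<^sub>R h) < \<delta>" "norm (t *\<^sub>R h) < \<delta>'"
    using False \<delta>(1) \<delta>'(1) by (auto simp: t_def)
  let ?y = "x + t *\<^sub>R h"
  have "t * norm (L h - L' h) = norm (L (t *\<^sub>R h) - L' (t *\<^sub>R h))"
    using t by (simp add: linear_scale[OF assms(1)] linear_scale[OF assms(2)] flip: scaleR_diff_right)
  also have "L (t *\<^sub>R h) - L' (t *\<^sub>R h) = (f ?y - f x - L' (t *\<^sub>R h)) - (f ?y - f x - L (t *\<^sub>R h))"
    by simp
  also have "norm \<dots> \<le> norm (f ?y - f x - L' (t *\<^sub>R h)) + norm (f ?y - f x - L (t *\<^sub>R h))"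
    by (rule norm_triangle_ineq4)
  also have "\<dots> \<le> c' * norm (t *\<^sub>R h) + c * norm (t *\<^sub>R h)"
    using \<delta>(2)[of ?y] \<delta>'(2)[of ?y] t by (intro add_mono) auto
  also have "\<dots> = t * ((c + c') * norm h)" using t by (simp add: algebra_simps)
  finally show ?thesis using t by simp
qed

lemma approx_at_perturb:
  assumes "approx_at f L c x" "\<And>h. norm (L h - L' h) \<le> c' * norm h"
  shows "approx_at f L' (c + c') x"
proof -
  obtain \<delta> where \<delta>: "\<delta> > 0" "\<And>y. norm (y - x) < \<delta> \<Longrightarrow> norm (f y - f x - L (y - x)) \<le> c * norm (y - x)"
    using approx_atE[OF assms(1)] by blast
  show ?thesis
  proof (rule approx_atI[OF \<delta>(1)])
    fix y assume y: "norm (y - x) < \<delta>"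
    have "f y - f x - L' (y - x) = (f y - f x - L (y - x)) + (L (y - x) - L' (y - x))" by simp
    then have "norm (f y - f x - L' (y - x)) \<le> norm (f y - f x - L (y - x)) + norm (L (y - x) - L' (y - x))"
      by (metis norm_triangle_ineq)
    also have "\<dots> \<le> c * norm (y - x) + c' * norm (y - x)"
      using \<delta>(2)[OF y] assms(2) by (intro add_mono)
    finally show "norm (f y - f x - L' (y - x)) \<le> (c + c') * norm (y - x)" by (simp add: algebra_simps)
  qed
qed

text \<open>The images of the basis vectors are chosen in a countable dense set; an error of
  \<open>e / DIM('a)\<close> for each of them adds up to \<open>e\<close>. This turns quantification
  over linear maps into a countable one.\<close>

lemma countable_dense_linear:
  obtains l :: "nat \<Rightarrow> 'a::euclidean_space \<Rightarrow> 'b::euclidean_space"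
  where "\<And>i. linear (l i)"
    "\<And>A e. linear A \<Longrightarrow> e > 0 \<Longrightarrow> \<exists>i. \<forall>h. norm (A h - l i h) \<le> e * norm h"
proof -
  obtain D :: "'b set" where D: "countable D" "\<And>X. open X \<Longrightarrow> X \<noteq> {} \<Longrightarrow> \<exists>d\<in>D. d \<in> X"
    using countable_dense_setE by blast
  define lin where "lin p h = (\<Sum>b\<in>Basis. (h \<bullet> b) *\<^sub>R p b)" for p :: "'a \<Rightarrow> 'b" and h
  define P where "P = (Basis :: 'a set) \<rightarrow>\<^sub>E D"
  have linear: "linear (lin p)" for p
    unfolding lin_def by (intro linearI) (simp_all add: inner_add_left scaleR_add_left sum.distrib scaleR_sum_right)
  have count: "countable P" unfolding P_def using D(1) by (intro countable_PiE) auto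
  have dense: "\<exists>p\<in>P. \<forall>h. norm (A h - lin p h) \<le> e * norm h" if A: "linear A" and e: "e > 0" for A and e :: real
  proof -
    define e' where "e' = e / real DIM('a)"
    have e': "e' > 0" using e by (simp add: e'_def)
    have "\<exists>d\<in>D. d \<in> ball (A b) e'" for b using D(2)[of "ball (A b) e'"] e' by auto
    then obtain q where q: "\<And>b. q b \<in> D" "\<And>b. q b \<in> ball (A b) e'" by metis
    define p where "p = restrict q Basis"
    have "p \<in> P" unfolding p_def P_def using q(1) by auto
    moreover have "norm (A h - lin p h) \<le> e * norm h" for h
    proof -
      have "A h = A (\<Sum>b\<in>Basis. (h \<bullet> b) *\<^sub>R b)" by (simp add: euclidean_representation)
      also have "\<dots> = (\<Sum>b\<in>Basis. (h \<bullet> b) *\<^sub>R A b)"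
        by (simp add: linear_sum[OF A] linear_scale[OF A])
      finally have "A h - lin p h = (\<Sum>b\<in>Basis. (h \<bullet> b) *\<^sub>R (A b - q b))"
        by (simp add: lin_def p_def scaleR_diff_right sum_subtractf)
      also have "norm \<dots> \<le> (\<Sum>b\<in>(Basis::'a set). norm h * e')"
      proof (intro sum_norm_le)
        fix b :: 'a assume "b \<in> Basis"
        then have "\<bar>h \<bullet> b\<bar> \<le> norm h" by (rule Basis_le_norm)
        moreover have "norm (A b - q b) \<le> e'" using q(2)[of b] by (simp add: dist_norm)
        ultimately show "norm ((h \<bullet> b) *\<^sub>R (A b - q b)) \<le> norm h * e'"
          by (simp add: mult_mono)
      qed
      also have "\<dots> = e * norm h" by (simp add: e'_def)
      finally show ?thesis .
    qed
    ultimately show ?thesis by blast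
  qed
  have "P \<noteq> {}" using dense[of "\<lambda>_. 0" 1] by (auto simp: linear_zero)
  then have range: "range (from_nat_into P) = P" using count by (rule range_from_nat_into)
  show ?thesis
  proof (rule that[of "\<lambda>i. lin (from_nat_into P i)"])
    show "linear (lin (from_nat_into P i))" for i by (rule linear)
    show "\<exists>i. \<forall>h. norm (A h - lin (from_nat_into P i) h) \<le> e * norm h"
      if "linear A" "e > 0" for A and e :: real
      using dense[OF that] range by (metis rangeE)
  qed
qed

text \<open>A Cauchy criterion for differentiability: approximants of growing accuracy at one point
  are mutually close by \<open>approx_at_diff_le\<close>, and their limit is the derivative. Its
  quantifiers are countable, so differentiability becomes a Borel condition on
  \<open>x\<close>.\<close>

lemma differentiable_iff_approx_at:
  fixes f :: "'a::euclidean_space \<Rightarrow> 'b::euclidean_space"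
  assumes lin: "\<And>i. linear (l i)"
    and dense: "\<And>A e. linear A \<Longrightarrow> e > 0 \<Longrightarrow> \<exists>i. \<forall>h. norm (A h - l i h) \<le> e * norm h"
  shows "f differentiable (at x) \<longleftrightarrow> (\<forall>k::nat. \<exists>i::nat. approx_at f (l i) (1 / real (Suc k)) x)"
proof
  assume "f differentiable (at x)"
  then obtain A where A: "(f has_derivative A) (at x)" by (auto simp: differentiable_def)
  show "\<forall>k. \<exists>i. approx_at f (l i) (1 / real (Suc k)) x"
  proof
    fix k
    define e where "e = 1 / real (Suc k) / 2"
    have "e > 0" by (simp add: e_def)
    obtain i where "\<forall>h. norm (A h - l i h) \<le> e * norm h"
      using dense[OF has_derivative_linear[OF A] \<open>e > 0\<close>] by blast
    moreover have "approx_at f A e x"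
      using A \<open>e > 0\<close> by (simp add: has_derivative_iff_approx_at)
    ultimately have "approx_at f (l i) (e + e) x" by (intro approx_at_perturb) auto
    moreover have "e + e = 1 / real (Suc k)" by (simp add: e_def field_simps)
    ultimately show "\<exists>i. approx_at f (l i) (1 / real (Suc k)) x" by metis
  qed
next
  assume "\<forall>k. \<exists>i. approx_at f (l i) (1 / real (Suc k)) x"
  then obtain s where s: "\<And>k. approx_at f (l (s k)) (1 / real (Suc k)) x" by metis
  define r where "r k = 1 / real (Suc k)" for k
  have r0: "r \<longlonglongrightarrow> 0" unfolding r_def using LIMSEQ_inverse_real_of_nat by (simp add: inverse_eq_divide)
  have diff: "norm (l (s k) h - l (s j) h) \<le> (r k + r j) * norm h" for k j h
    unfolding r_def by (rule approx_at_diff_le[OF lin lin s s])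
  have rmono: "r j \<le> r k" if "k \<le> j" for k j using that by (simp add: r_def frac_le)
  have "Cauchy (\<lambda>k. l (s k) h)" for h
  proof (rule metric_CauchyI)
    fix e :: real assume e: "e > 0"
    have "(\<lambda>k. 2 * r k * norm h) \<longlonglongrightarrow> 2 * 0 * norm h" by (intro tendsto_intros r0)
    then have "eventually (\<lambda>k. 2 * r k * norm h < e) sequentially" using e by (intro order_tendstoD(2)) auto
    then obtain N where N: "2 * r N * norm h < e" unfolding eventually_sequentially by blast
    have "dist (l (s m) h) (l (s n) h) < e" if "m \<ge> N" "n \<ge> N" for m n
    proof -
      have "dist (l (s m) h) (l (s n) h) \<le> (r m + r n) * norm h" using diff by (simp add: dist_norm)
      also have "\<dots> \<le> (r N + r N) * norm h" using rmono that by (intro mult_right_mono add_mono) auto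
      finally show ?thesis using N by simp
    qed
    then show "\<exists>M. \<forall>m\<ge>M. \<forall>n\<ge>M. dist (l (s m) h) (l (s n) h) < e" by blast
  qed
  then have "\<forall>h. \<exists>a. (\<lambda>k. l (s k) h) \<longlonglongrightarrow> a" by (simp add: Cauchy_convergent_iff convergent_def)
  then obtain A where A: "\<And>h. (\<lambda>k. l (s k) h) \<longlonglongrightarrow> A h" by metis
  have "linear A"
  proof (rule linearI)
    fix a b and c :: real
    have "(\<lambda>k. l (s k) (a + b)) \<longlonglongrightarrow> A a + A b"
      unfolding linear_add[OF lin] by (intro tendsto_add A)
    then show "A (a + b) = A a + A b" using A LIMSEQ_unique by blast
    have "(\<lambda>k. l (s k) (c *\<^sub>R a)) \<longlonglongrightarrow> c *\<^sub>R A a"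
      unfolding linear_scale[OF lin] by (intro tendsto_scaleR tendsto_const A)
    then show "A (c *\<^sub>R a) = c *\<^sub>R A a" using A LIMSEQ_unique by blast
  qed
  have close: "norm (l (s k) h - A h) \<le> r k * norm h" for k h
  proof (rule LIMSEQ_le)
    show "(\<lambda>j. norm (l (s k) h - l (s j) h)) \<longlonglongrightarrow> norm (l (s k) h - A h)" by (intro tendsto_intros A)
    have "(\<lambda>j. (r k + r j) * norm h) \<longlonglongrightarrow> (r k + 0) * norm h" by (intro tendsto_intros r0)
    then show "(\<lambda>j. (r k + r j) * norm h) \<longlonglongrightarrow> r k * norm h" by simp
  qed (use diff in blast)
  have "approx_at f A e x" if "e > 0" for e
  proof -
    have "(\<lambda>k. r k + r k) \<longlonglongrightarrow> 0 + 0" by (intro tendsto_intros r0)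
    then have "eventually (\<lambda>k. r k + r k < e) sequentially" using that by (intro order_tendstoD(2)) auto
    then obtain k where k: "r k + r k < e" unfolding eventually_sequentially by blast
    have "approx_at f A (r k + r k) x"
      using approx_at_perturb[OF s[of k] close[of k]] by (simp add: r_def)
    then obtain \<delta> where \<delta>: "\<delta> > 0" "\<And>y. norm (y - x) < \<delta> \<Longrightarrow> norm (f y - f x - A (y - x)) \<le> (r k + r k) * norm (y - x)"
      using approx_atE by blast
    show ?thesis
    proof (rule approx_atI[OF \<delta>(1)])
      fix y assume "norm (y - x) < \<delta>"
      from \<delta>(2)[OF this] k show "norm (f y - f x - A (y - x)) \<le> e * norm (y - x)"
        by (meson less_imp_le mult_right_mono norm_ge_zero order_trans)
    qed
  qed
  then have "(f has_derivative A) (at x)"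
    using \<open>linear A\<close> by (simp add: has_derivative_iff_approx_at linear_linear)
  then show "f differentiable (at x)" by (auto simp: differentiable_def)
qed

text \<open>Where \<open>f\<close> is not differentiable, \<open>frechet_derivative\<close> is a choice from the empty predicate, hence
  one fixed map.\<close>

lemma borel_measurable_frechet_derivative:
  fixes f :: "'a::euclidean_space \<Rightarrow> 'b::euclidean_space"
  shows "(\<lambda>x. frechet_derivative f (at x) v) \<in> borel_measurable borel"
proof -
  obtain l :: "nat \<Rightarrow> 'a \<Rightarrow> 'b" where lin: "\<And>i. linear (l i)"
    and dense: "\<And>A e. linear A \<Longrightarrow> e > 0 \<Longrightarrow> \<exists>i. \<forall>h. norm (A h - l i h) \<le> e * norm h"
    using countable_dense_linear by blast
  note [measurable] = pred_approx_at[OF lin]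
  have diff_iff: "f differentiable (at x) \<longleftrightarrow> (\<forall>k. \<exists>i. approx_at f (l i) (1 / real (Suc k)) x)" for x
    by (rule differentiable_iff_approx_at[OF lin dense])
  \<comment> \<open>Taking the least index makes the choice of an approximant measurable in
    \<open>x\<close>.\<close>
  define idx where "idx k x = (LEAST i. approx_at f (l i) (1 / real (Suc k)) x)" for k x
  define g where "g k x = (if f differentiable (at x) then l (idx k x) v else (SOME A. False) v)" for k x
  show ?thesis
  proof (rule borel_measurable_LIMSEQ_metric)
    fix k
    have [measurable]: "idx k \<in> measurable borel (count_space UNIV)"
      unfolding idx_def by measurable
    have [measurable]: "(\<lambda>x. l (idx k x) v) \<in> borel_measurable borel"
      by (rule measurable_compose[of "idx k" borel "count_space UNIV" "\<lambda>i. l i v"]) auto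
    have [measurable]: "Measurable.pred borel (\<lambda>x. f differentiable (at x))"
      by (simp only: diff_iff) measurable
    show "g k \<in> borel_measurable borel"
      unfolding g_def by measurable
  next
    fix x
    show "(\<lambda>k. g k x) \<longlonglongrightarrow> frechet_derivative f (at x) v"
    proof (cases "f differentiable (at x)")
      case True
      let ?A = "frechet_derivative f (at x)"
      have A: "(f has_derivative ?A) (at x)" using True by (simp add: frechet_derivative_works)
      have close: "norm (l (idx k x) v - ?A v) \<le> 2 * norm v * (1 / real (Suc k))" for k
      proof -
        have "\<exists>i. approx_at f (l i) (1 / real (Suc k)) x" using True diff_iff by blast
        then have "approx_at f (l (idx k x)) (1 / real (Suc k)) x" unfolding idx_def by (rule LeastI_ex)
        moreover have "approx_at f ?A (1 / real (Suc k)) x"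
          using A by (simp add: has_derivative_iff_approx_at)
        ultimately have "norm (l (idx k x) v - ?A v) \<le> (1 / real (Suc k) + 1 / real (Suc k)) * norm v"
          using lin has_derivative_linear[OF A] by (intro approx_at_diff_le)
        then show ?thesis by (simp add: algebra_simps)
      qed
      have "(\<lambda>k. 1 / real (Suc k)) \<longlonglongrightarrow> 0"
        using LIMSEQ_inverse_real_of_nat by (simp add: inverse_eq_divide)
      then have "(\<lambda>k. 2 * norm v * (1 / real (Suc k))) \<longlonglongrightarrow> 0"
        by (rule tendsto_mult_right_zero)
      then have "(\<lambda>k. l (idx k x) v - ?A v) \<longlonglongrightarrow> 0"
        by (rule Lim_null_comparison[rotated]) (use close in auto)
      then show ?thesis using True by (simp add: g_def LIM_zero_iff)
    next
      case False
      then have "(\<lambda>A. (f has_derivative A) (at x)) = (\<lambda>_. False)" by (auto simp: differentiable_def)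
      then have "frechet_derivative f (at x) = (SOME A. False)" by (simp add: frechet_derivative_def)
      then show ?thesis using False by (simp add: g_def)
    qed
  qed
qed

text \<open>The values of \<open>f\<close> outside \<open>U\<close> are arbitrary, yet
  \<open>ln (jacobian f x)\<close> is integrated over the whole space. Hence measurability is
  established for every map, not only for holomorphic ones.\<close>

lemma borel_measurable_jacobian: "jacobian f \<in> borel_measurable borel"
proof -
  have "(\<lambda>x. frechet_derivative f (at x) (axis j 1) $ i) \<in> borel_measurable borel" for i j
    using borel_measurable_frechet_derivative[of f "axis j 1"]
    by (rule measurable_compose) (intro borel_measurable_continuous_onI continuous_intros)
  then show ?thesis
    unfolding jacobian_def det_def cjac_matrix_def by simp
qed

section \<open>The area inequality with multiplicities\<close>

lemma emeasure_differentiable_image_le: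
  fixes f :: "real^'n::{finite,wellorder} \<Rightarrow> real^'n::_"
  assumes S: "S \<in> sets lebesgue"
    and deriv: "\<And>x. x \<in> S \<Longrightarrow> (f has_derivative f' x) (at x within S)"
  shows "emeasure lebesgue (f ` S) \<le> (\<integral>\<^sup>+x\<in>S. ennreal \<bar>det (matrix (f' x))\<bar> \<partial>lebesgue)" (is "_ \<le> ?I")
proof (cases "?I = \<infinity>")
  case False
  let ?d = "\<lambda>x. \<bar>det (matrix (f' x))\<bar>"
  have "?d \<in> borel_measurable (lebesgue_on S)"
    using borel_measurable_det_Jacobian[OF S deriv] by measurable
  then have meas: "(\<lambda>x. indicator S x *\<^sub>R ?d x) \<in> borel_measurable lebesgue"
    using S by (simp add: borel_measurable_restrict_space_iff)
  have I: "?I = (\<integral>\<^sup>+x. ennreal (indicator S x *\<^sub>R ?d x) \<partial>lebesgue)"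
    by (intro nn_integral_cong) (simp add: indicator_def)
  have "(\<integral>\<^sup>+x. ennreal (indicator S x *\<^sub>R ?d x) \<partial>lebesgue) < \<infinity>"
    using False by (simp add: I less_top)
  then have int: "set_integrable lebesgue S ?d"
    unfolding set_integrable_def using meas by (intro integrableI_nonneg) auto
  have eq: "?I = ennreal (integral S ?d)"
    unfolding I set_lebesgue_integral_eq_integral(2)[OF int, symmetric] set_lebesgue_integral_def
    using int by (intro nn_integral_eq_integral) (auto simp: set_integrable_def)
  have io: "?d integrable_on S" using set_lebesgue_integral_eq_integral(1)[OF int] .
  show ?thesis
    unfolding eq
    using measurable_differentiable_image[OF S deriv io] measure_differentiable_image[OF S deriv io]
    by (simp add: emeasure_eq_measure2 ennreal_leI)
qed simp

text \<open>The area bound is carried over to \<open>'a\<close> by conjugating \<open>f\<close> with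
  the coordinate isometry, which preserves Lebesgue measure. The function \<open>w\<close>
  represents the Jacobian on \<open>S\<close> by one that is measurable everywhere, so its integral
  can be transported.\<close>

lemma emeasure_differentiable_image_le_euclidean:
  fixes f :: "'a::euclidean_space \<Rightarrow> 'a" and \<beta> :: "'n::{finite,wellorder} \<Rightarrow> 'a"
  assumes \<beta>: "bij_betw \<beta> UNIV Basis"
    and S: "S \<in> sets lebesgue"
    and deriv: "\<And>x. x \<in> S \<Longrightarrow> (f has_derivative f' x) (at x within S)"
    and w: "w \<in> borel_measurable lebesgue" "\<And>x. x \<in> S \<Longrightarrow> w x = ennreal (abs_det \<beta> (f' x))"
  shows "emeasure lebesgue (f ` S) \<le> (\<integral>\<^sup>+x\<in>S. w x \<partial>lebesgue)"
proof -
  let ?T = "of_coords \<beta>" and ?R = "to_coords \<beta>"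
  note [simp] = to_of_coords[OF \<beta>] of_to_coords[OF \<beta>]
  define S' where "S' = ?T -` S"
  have S': "S' \<in> sets lebesgue"
    using measurable_sets[OF measurable_of_coords[OF \<beta>] S] by (simp add: S'_def)
  have T: "(?T has_derivative ?T) F" and R: "(?R has_derivative ?R) G" for F G
    by (auto intro!: bounded_linear_imp_has_derivative simp: linear_linear linear_of_coords linear_to_coords)
  have der: "((?R \<circ> f \<circ> ?T) has_derivative (?R \<circ> f' (?T x) \<circ> ?T)) (at x within S')" if "x \<in> S'" for x
  proof -
    have "?T ` S' \<subseteq> S" by (auto simp: S'_def)
    moreover have "?T x \<in> S" using that by (simp add: S'_def)
    ultimately have "(f has_derivative f' (?T x)) (at (?T x) within ?T ` S')"
      using deriv has_derivative_subset by blast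
    from diff_chain_within[OF T this] have "((f \<circ> ?T) has_derivative (f' (?T x) \<circ> ?T)) (at x within S')" .
    from diff_chain_within[OF this R] show ?thesis by (simp add: o_assoc)
  qed
  have "f differentiable_on S"
    using deriv unfolding differentiable_on_def differentiable_def by blast
  then have fS: "f ` S \<in> sets lebesgue"
    by (intro differentiable_image_in_sets_lebesgue[OF S]) auto
  have im: "?T -` (f ` S) = (?R \<circ> f \<circ> ?T) ` S'"
  proof (intro set_eqI iffI)
    fix x assume "x \<in> ?T -` (f ` S)"
    then obtain s where s: "s \<in> S" "?T x = f s" by auto
    then have "x = (?R \<circ> f \<circ> ?T) (?R s)" "?R s \<in> S'"
      by (simp_all add: S'_def) (metis to_of_coords[OF \<beta>])
    then show "x \<in> (?R \<circ> f \<circ> ?T) ` S'" by blast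
  qed (auto simp: S'_def)
  have "emeasure lebesgue (f ` S) = emeasure (distr lebesgue lebesgue ?T) (f ` S)"
    by (simp add: lebesgue_of_coords[OF \<beta>])
  also have "\<dots> = emeasure lebesgue ((?R \<circ> f \<circ> ?T) ` S')"
    using fS by (simp add: emeasure_distr measurable_of_coords[OF \<beta>] im del: emeasure_completion)
  also have "\<dots> \<le> (\<integral>\<^sup>+x\<in>S'. ennreal \<bar>det (matrix (?R \<circ> f' (?T x) \<circ> ?T))\<bar> \<partial>lebesgue)"
    by (rule emeasure_differentiable_image_le[OF S' der])
  also have "\<dots> = (\<integral>\<^sup>+x. w (?T x) * indicator S (?T x) \<partial>lebesgue)"
    by (intro nn_integral_cong) (auto simp: S'_def indicator_def w(2) abs_det_def)
  also have "\<dots> = (\<integral>\<^sup>+x\<in>S. w x \<partial>distr lebesgue lebesgue ?T)"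
    using w(1) S by (subst nn_integral_distr[OF measurable_of_coords[OF \<beta>]]) auto
  finally show ?thesis by (simp only: lebesgue_of_coords[OF \<beta>])
qed

text \<open>An integral against counting measure instead of a finite sum: it is meaningful over
  every \<open>y\<close>, whatever the size of the fibre, and inherits additivity and monotone
  convergence.\<close>

definition fiber_sum :: "('a \<Rightarrow> 'b) \<Rightarrow> 'a set \<Rightarrow> ('a \<Rightarrow> ennreal) \<Rightarrow> 'b \<Rightarrow> ennreal" where
  "fiber_sum f E h y = (\<integral>\<^sup>+x. h x \<partial>count_space {x\<in>E. f x = y})"

lemma fiber_sum_indicator:
  "fiber_sum f E (indicator B) y = emeasure (count_space UNIV) {x\<in>B \<inter> E. f x = y}"
proof -
  have "fiber_sum f E (indicator B) y = (\<integral>\<^sup>+x. indicator B x * indicator {x\<in>E. f x = y} x \<partial>count_space UNIV)"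
    unfolding fiber_sum_def by (subst nn_integral_count_space_indicator) simp_all
  also have "\<dots> = (\<integral>\<^sup>+x. indicator {x\<in>B \<inter> E. f x = y} x \<partial>count_space UNIV)"
    by (intro nn_integral_cong) (auto simp: indicator_def)
  finally show ?thesis by simp
qed

lemma fiber_sum_add: "fiber_sum f E (\<lambda>x. h x + h' x) y = fiber_sum f E h y + fiber_sum f E h' y"
  unfolding fiber_sum_def by (rule nn_integral_add) auto

lemma fiber_sum_cmult: "fiber_sum f E (\<lambda>x. c * h x) y = c * fiber_sum f E h y"
  unfolding fiber_sum_def by (rule nn_integral_cmult) auto

lemma fiber_sum_SUP:
  assumes "incseq H"
  shows "fiber_sum f E (\<lambda>x. SUP i. H i x) y = (SUP i. fiber_sum f E (H i) y)"
  unfolding fiber_sum_def using assms by (intro nn_integral_monotone_convergence_SUP) auto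

lemma fiber_sum_finite:
  assumes "finite {x\<in>E. f x = y}"
  shows "fiber_sum f E h y = (\<Sum>x | x \<in> E \<and> f x = y. h x)"
  unfolding fiber_sum_def using assms by (simp add: nn_integral_count_space_finite)

lemma separating_open_sequence:
  obtains B :: "nat \<Rightarrow> 'a::euclidean_space set"
  where "\<And>n. open (B n)" "\<And>x y. x \<noteq> y \<Longrightarrow> \<exists>n. x \<in> B n \<and> y \<notin> B n"
proof -
  obtain B :: "nat \<Rightarrow> 'a set" where B: "\<And>n. open (B n)" "\<And>S. open S \<Longrightarrow> \<exists>k. S = \<Union>{B n |n. n \<in> k}"
    by (rule univ_second_countable_sequence) blast
  have "\<exists>n. x \<in> B n \<and> y \<notin> B n" if "x \<noteq> y" for x y
  proof -
    obtain k where k: "- {y} = \<Union>{B n |n. n \<in> k}" using B(2)[of "- {y}"] by auto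
    then have "x \<in> \<Union>{B n |n. n \<in> k}" using that by (simp flip: k)
    then obtain n where "n \<in> k" "x \<in> B n" by auto
    moreover have "y \<notin> B n" using k \<open>n \<in> k\<close> by blast
    ultimately show ?thesis by blast
  qed
  with B that show ?thesis by blast
qed

text \<open>The multiplicity function is the increasing limit of the functions counting the pieces, of finer
  and finer finite partitions, whose image contains the point.\<close>

lemma fiber_sum_indicator_area:
  fixes f :: "'a::euclidean_space \<Rightarrow> 'b::euclidean_space"
  assumes img: "\<And>B. B \<in> sets lebesgue \<Longrightarrow> B \<subseteq> E \<Longrightarrow> f ` B \<in> sets lebesgue"
    "\<And>B. B \<in> sets lebesgue \<Longrightarrow> B \<subseteq> E \<Longrightarrow> emeasure lebesgue (f ` B) \<le> (\<integral>\<^sup>+x\<in>B. w x \<partial>lebesgue)"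
    and w: "w \<in> borel_measurable lebesgue" and E: "E \<in> sets lebesgue" and B: "B \<in> sets lebesgue"
  shows "fiber_sum f E (indicator B) \<in> borel_measurable lebesgue"
    and "(\<integral>\<^sup>+y. fiber_sum f E (indicator B) y \<partial>lebesgue) \<le> (\<integral>\<^sup>+x\<in>E. indicator B x * w x \<partial>lebesgue)"
proof -
  obtain Q :: "nat \<Rightarrow> 'a set" where Q: "\<And>n. open (Q n)" "\<And>x y. x \<noteq> y \<Longrightarrow> \<exists>n. x \<in> Q n \<and> y \<notin> Q n"
    using separating_open_sequence by blast
  \<comment> \<open>\<open>q m x\<close> labels \<open>x\<close> by those of the first
    \<open>m\<close> open sets that contain it; the cells \<open>A m s\<close> are its level sets in
    \<open>B \<inter> E\<close>, and \<open>N m y\<close> is the number of distinct labels in the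
    fibre over \<open>y\<close>.\<close>
  define q where "q m x = {i\<in>{..<m}. x \<in> Q i}" for m x
  define fib where "fib y = {x\<in>B \<inter> E. f x = y}" for y
  define A where "A m s = {x\<in>B \<inter> E. q m x = s}" for m s
  define N :: "nat \<Rightarrow> 'b \<Rightarrow> ennreal" where "N m y = (\<Sum>s\<in>Pow {..<m}. indicator (f ` A m s) y)" for m y
  have A: "A m s \<in> sets lebesgue" for m s
  proof (cases "s \<subseteq> {..<m}")
    case True
    have eq: "A m s = (B \<inter> E) \<inter> {x \<in> space lebesgue. \<forall>i\<in>{..<m}. x \<in> Q i \<longleftrightarrow> i \<in> s}"
      using True by (auto simp: A_def q_def)
    have "{x \<in> space lebesgue. x \<in> Q i \<longleftrightarrow> i \<in> s} \<in> sets lebesgue" for i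
    proof -
      have "{x \<in> space lebesgue. x \<in> Q i \<longleftrightarrow> i \<in> s} = (if i \<in> s then Q i else - Q i)" by auto
      then show ?thesis using Q(1)[of i] by (auto intro!: sets_completionI_sets)
    qed
    then show ?thesis
      unfolding eq using B E by (intro sets.Int sets.sets_Collect_finite_All) auto
  next
    case False
    then have "A m s = {}" by (auto simp: A_def q_def)
    then show ?thesis by simp
  qed
  have AE: "A m s \<subseteq> E" for m s by (auto simp: A_def)
  have fA [measurable]: "f ` A m s \<in> sets lebesgue" for m s using img(1)[OF A AE] .
  have N_meas [measurable]: "N m \<in> borel_measurable lebesgue" for m
    unfolding N_def by measurable
  have qfin: "finite (q m ` F)" for m F
    by (rule finite_subset[of _ "Pow {..<m}"]) (auto simp: q_def)
  have N: "N m y = of_nat (card (q m ` fib y))" for m y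
  proof -
    have "(\<Sum>s\<in>Pow {..<m}. indicator (f ` A m s) y :: ennreal) = (\<Sum>s\<in>Pow {..<m}. if s \<in> q m ` fib y then 1 else 0)"
      by (intro sum.cong) (auto simp: indicator_def A_def fib_def)
    also have "\<dots> = of_nat (card (Pow {..<m} \<inter> q m ` fib y))"
      by (subst sum.inter_restrict[symmetric]) auto
    also have "Pow {..<m} \<inter> q m ` fib y = q m ` fib y" by (auto simp: q_def)
    finally show ?thesis by (simp add: N_def)
  qed
  have Nmono: "incseq (\<lambda>m. N m)"
  proof (intro incseq_SucI le_funI)
    fix m y
    \<comment> \<open>Labels of stage \<open>m\<close> are truncations of labels of stage
      \<open>Suc m\<close>, so refining can only increase their number.\<close>
    have "q m ` fib y = (\<lambda>s. s \<inter> {..<m}) ` q (Suc m) ` fib y"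
      unfolding image_image by (intro image_cong) (auto simp: q_def)
    then have "card (q m ` fib y) \<le> card (q (Suc m) ` fib y)"
      using card_image_le[OF qfin] by metis
    then show "N m y \<le> N (Suc m) y" by (simp add: N)
  qed
  have sep: "\<exists>m. of_nat (card F) \<le> N m y" if F: "finite F" "F \<subseteq> fib y" for F y
  proof -
    obtain n where n: "\<And>x x'. x \<noteq> x' \<Longrightarrow> x \<in> Q (n x x') \<and> x' \<notin> Q (n x x')"
      using Q(2) by metis
    \<comment> \<open>\<open>m\<close> exceeds the indices of the separating sets of all pairs from
      \<open>F\<close>, so the labels of stage \<open>m\<close> tell the points of \<open>F\<close>
      apart.\<close>
    obtain m where m: "\<And>k. k \<in> (\<lambda>(x, x'). n x x') ` (F \<times> F) \<Longrightarrow> k < m"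
      using F(1) finite_nat_iff_bounded[of "(\<lambda>(x, x'). n x x') ` (F \<times> F)"] by auto
    have "inj_on (q m) F"
    proof (rule inj_onI, rule ccontr)
      fix x x' assume x: "x \<in> F" "x' \<in> F" "q m x = q m x'" "x \<noteq> x'"
      then have "n x x' < m" by (intro m) auto
      then have "n x x' \<in> q m x" "n x x' \<notin> q m x'" using n[OF x(4)] by (auto simp: q_def)
      with x show False by simp
    qed
    then have "card F = card (q m ` F)" by (simp add: card_image)
    also have "\<dots> \<le> card (q m ` fib y)" using F(2) by (intro card_mono qfin) auto
    finally show ?thesis by (intro exI[of _ m]) (simp add: N)
  qed
  have lim: "fiber_sum f E (indicator B) y = (SUP m. N m y)" for y
  proof (rule antisym)
    have "emeasure (count_space UNIV) (fib y) \<le> (SUP m. N m y)"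
    proof (cases "finite (fib y)")
      case True
      obtain m where "of_nat (card (fib y)) \<le> N m y" using sep[OF True] by auto
      then show ?thesis using True by (auto intro: SUP_upper2[of m])
    next
      case False
      have "of_nat k \<le> (SUP m. N m y)" for k
      proof -
        obtain F where "F \<subseteq> fib y" "finite F" "card F = k"
          using infinite_arbitrarily_large[OF False] by blast
        then show ?thesis using sep[of F y] by (auto intro: SUP_upper2)
      qed
      then have "(SUP k. of_nat k :: ennreal) \<le> (SUP m. N m y)" by (intro SUP_least)
      then have top: "(SUP m. N m y) = top" by (simp add: ennreal_SUP_of_nat_eq_top top_unique)
      show ?thesis unfolding top by (rule top_greatest)
    qed
    then show "fiber_sum f E (indicator B) y \<le> (SUP m. N m y)"
      by (simp only: fiber_sum_indicator fib_def)
    show "(SUP m. N m y) \<le> fiber_sum f E (indicator B) y"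
      unfolding fiber_sum_indicator fib_def[symmetric] N
      by (rule SUP_least, cases "finite (fib y)") (auto simp: card_image_le)
  qed
  show "fiber_sum f E (indicator B) \<in> borel_measurable lebesgue"
    unfolding lim[abs_def] by measurable
  have "(\<integral>\<^sup>+y. N m y \<partial>lebesgue) \<le> (\<integral>\<^sup>+x\<in>E. indicator B x * w x \<partial>lebesgue)" for m
  proof -
    have "(\<integral>\<^sup>+y. N m y \<partial>lebesgue) = (\<Sum>s\<in>Pow {..<m}. emeasure lebesgue (f ` A m s))"
      unfolding N_def by (subst nn_integral_sum) (auto simp del: emeasure_completion)
    also have "\<dots> \<le> (\<Sum>s\<in>Pow {..<m}. \<integral>\<^sup>+x\<in>A m s. w x \<partial>lebesgue)"
      by (intro sum_mono img(2) A AE)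
    also have "\<dots> = (\<integral>\<^sup>+x. (\<Sum>s\<in>Pow {..<m}. w x * indicator (A m s) x) \<partial>lebesgue)"
      using w A by (intro nn_integral_sum[symmetric]) auto
    also have "\<dots> = (\<integral>\<^sup>+x\<in>E. indicator B x * w x \<partial>lebesgue)"
    proof (intro nn_integral_cong)
      fix x
      have "(\<Sum>s\<in>Pow {..<m}. w x * indicator (A m s) x) = (\<Sum>s\<in>Pow {..<m}. if s = q m x then w x * indicator (B \<inter> E) x else 0)"
        by (intro sum.cong) (auto simp: A_def indicator_def)
      also have "\<dots> = w x * indicator (B \<inter> E) x"
        by (subst sum.delta) (auto simp: q_def)
      finally show "(\<Sum>s\<in>Pow {..<m}. w x * indicator (A m s) x) = indicator B x * w x * indicator E x"
        by (simp add: indicator_def)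
    qed
    finally show ?thesis .
  qed
  then show "(\<integral>\<^sup>+y. fiber_sum f E (indicator B) y \<partial>lebesgue) \<le> (\<integral>\<^sup>+x\<in>E. indicator B x * w x \<partial>lebesgue)"
    unfolding lim by (subst nn_integral_monotone_convergence_SUP[OF Nmono]) (auto intro: SUP_least)
qed

lemma fiber_sum_area:
  fixes f :: "'a::euclidean_space \<Rightarrow> 'b::euclidean_space"
  assumes img: "\<And>B. B \<in> sets lebesgue \<Longrightarrow> B \<subseteq> E \<Longrightarrow> f ` B \<in> sets lebesgue"
    "\<And>B. B \<in> sets lebesgue \<Longrightarrow> B \<subseteq> E \<Longrightarrow> emeasure lebesgue (f ` B) \<le> (\<integral>\<^sup>+x\<in>B. w x \<partial>lebesgue)"
    and w: "w \<in> borel_measurable lebesgue" and E: "E \<in> sets lebesgue" and h: "h \<in> borel_measurable lebesgue"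
  shows "fiber_sum f E h \<in> borel_measurable lebesgue \<and>
    (\<integral>\<^sup>+y. fiber_sum f E h y \<partial>lebesgue) \<le> (\<integral>\<^sup>+x\<in>E. h x * w x \<partial>lebesgue)"
  using h
proof (induction rule: borel_measurable_induct)
  case (cong g h)
  then have "g = h" by auto
  with cong show ?case by simp
next
  case (set B)
  then show ?case using fiber_sum_indicator_area[OF img w E set] by blast
next
  case (mult u c)
  have "(\<integral>\<^sup>+y. c * fiber_sum f E u y \<partial>lebesgue) \<le> c * (\<integral>\<^sup>+x\<in>E. u x * w x \<partial>lebesgue)"
    using mult by (simp add: nn_integral_cmult mult_left_mono)
  also have "\<dots> = (\<integral>\<^sup>+x\<in>E. c * u x * w x \<partial>lebesgue)"
    using mult w E by (subst nn_integral_cmult[symmetric]) (auto simp: mult.assoc)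
  finally show ?case using mult by (auto simp: fiber_sum_cmult[abs_def])
next
  case (add u v)
  have "(\<integral>\<^sup>+y. fiber_sum f E u y + fiber_sum f E v y \<partial>lebesgue)
      \<le> (\<integral>\<^sup>+x\<in>E. u x * w x \<partial>lebesgue) + (\<integral>\<^sup>+x\<in>E. v x * w x \<partial>lebesgue)"
    using add by (simp add: nn_integral_add add_mono)
  also have "\<dots> = (\<integral>\<^sup>+x\<in>E. (v x + u x) * w x \<partial>lebesgue)"
    using add w E by (subst nn_integral_add[symmetric]) (auto simp: distrib_right add.commute)
  finally show ?case using add by (auto simp: fiber_sum_add[abs_def] add.commute)
next
  case (seq H)
  have eq: "fiber_sum f E (SUP i. H i) = (\<lambda>y. SUP i. fiber_sum f E (H i) y)"
    using fiber_sum_SUP[OF seq(3), of f E] by (simp add: fun_eq_iff image_image SUP_apply[abs_def])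
  have inc: "incseq (\<lambda>i. fiber_sum f E (H i))"
    using seq(3) by (auto simp: incseq_def le_fun_def fiber_sum_def intro!: nn_integral_mono)
  have "(\<integral>\<^sup>+y. (SUP i. fiber_sum f E (H i) y) \<partial>lebesgue) = (SUP i. \<integral>\<^sup>+y. fiber_sum f E (H i) y \<partial>lebesgue)"
    using seq inc by (intro nn_integral_monotone_convergence_SUP) auto
  also have "\<dots> \<le> (\<integral>\<^sup>+x\<in>E. (SUP i. H i) x * w x \<partial>lebesgue)"
  proof (rule SUP_least)
    fix i
    have "(\<integral>\<^sup>+y. fiber_sum f E (H i) y \<partial>lebesgue) \<le> (\<integral>\<^sup>+x\<in>E. H i x * w x \<partial>lebesgue)"
      using seq by blast
    also have "\<dots> \<le> (\<integral>\<^sup>+x\<in>E. (SUP i. H i) x * w x \<partial>lebesgue)"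
      by (intro nn_integral_mono mult_right_mono) (auto simp: SUP_apply intro: SUP_upper)
    finally show "(\<integral>\<^sup>+y. fiber_sum f E (H i) y \<partial>lebesgue) \<le> (\<integral>\<^sup>+x\<in>E. (SUP i. H i) x * w x \<partial>lebesgue)" .
  qed
  finally show ?case using seq unfolding eq by (auto intro!: borel_measurable_SUP)
qed

section \<open>Pull-backs under polynomial-like maps\<close>

text \<open>\<open>ennreal (h x)\<close> is the positive part of \<open>h x\<close>, whose integral
  dominates that of \<open>h\<close>. The bound \<open>c \<ge> 0\<close> also covers the default
  value 0 of the integral of a non-integrable function.\<close>

lemma real_integral_le_nn_integral:
  fixes h :: "'a \<Rightarrow> real"
  assumes "(\<integral>\<^sup>+x. ennreal (h x) \<partial>M) \<le> ennreal c" "c \<ge> 0"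
  shows "(\<integral>x. h x \<partial>M) \<le> c"
proof (cases "integrable M h")
  case True
  have "(\<integral>x. h x \<partial>M) \<le> enn2real (\<integral>\<^sup>+x. ennreal (h x) \<partial>M)"
    using True by (simp add: real_lebesgue_integral_def)
  also have "\<dots> \<le> enn2real (ennreal c)"
    using assms by (intro enn2real_mono) auto
  finally show ?thesis using assms by simp
qed (simp add: not_integrable_integral_eq assms)

text \<open>Jensen's inequality for a uniform average: bound each term from below by the tangent
  line at the mean; the linear parts cancel in the sum.\<close>

lemma sum_exp_ge_card_exp_average:
  fixes a :: "'a \<Rightarrow> real"
  assumes "finite A" "A \<noteq> {}"
  shows "real (card A) * exp (- ((\<Sum>v\<in>A. a v) / real (card A))) \<le> (\<Sum>v\<in>A. exp (- a v))"
proof -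
  define m where "m = (\<Sum>v\<in>A. a v) / real (card A)"
  have "card A > 0" using assms by (simp add: card_gt_0_iff)
  then have sum: "(\<Sum>v\<in>A. 1 + (m - a v)) = real (card A)"
    by (simp add: sum.distrib sum_subtractf m_def)
  have "exp (- m) * (1 + (m - a v)) \<le> exp (- a v)" for v
    using mult_left_mono[OF exp_ge_add_one_self[of "m - a v"], of "exp (- m)"]
    by (simp add: exp_add[symmetric])
  then have "(\<Sum>v\<in>A. exp (- m) * (1 + (m - a v))) \<le> (\<Sum>v\<in>A. exp (- a v))"
    by (intro sum_mono)
  then show ?thesis
    unfolding m_def[symmetric] sum_distrib_left[symmetric] sum by (simp add: mult.commute)
qed

text \<open>A Cesaro argument: were \<open>l < c\<close>, all late terms would lie below
  \<open>c - e\<close>, with \<open>e\<close> half the gap, and the partial sums would fall behind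
  \<open>n * c\<close> at a linear rate.\<close>

lemma limit_ge_of_partial_sums_ge:
  fixes a :: "nat \<Rightarrow> real"
  assumes lim: "a \<longlonglongrightarrow> l" and sums: "\<And>n. real n * c \<le> (\<Sum>j<n. a j)"
  shows "c \<le> l"
proof (rule ccontr)
  assume "\<not> c \<le> l"
  define e where "e = (c - l) / 2"
  have e: "e > 0" using \<open>\<not> c \<le> l\<close> by (simp add: e_def)
  have "eventually (\<lambda>n. a n < c - e) sequentially"
    using order_tendstoD(2)[OF lim, of "c - e"] \<open>\<not> c \<le> l\<close> by (simp add: e_def field_simps)
  then obtain N where N: "\<And>n. n \<ge> N \<Longrightarrow> a n < c - e"
    unfolding eventually_sequentially by blast
  have "real m * e \<le> (\<Sum>j<N. a j) - real N * c" for m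
  proof -
    have "real (N + m) * c \<le> (\<Sum>j<N + m. a j)" by (rule sums)
    also have "\<dots> = (\<Sum>j<N. a j) + (\<Sum>j<m. a (N + j))"
      by (induction m) auto
    also have "(\<Sum>j<m. a (N + j)) \<le> (\<Sum>j<m. c - e)"
      using N by (intro sum_mono less_imp_le) auto
    finally show ?thesis by (simp add: algebra_simps)
  qed
  moreover obtain m where "(\<Sum>j<N. a j) - real N * c < real m * e"
    using reals_Archimedean3[OF e] by blast
  ultimately show False by (meson not_less)
qed

locale polynomial_like_degree =
  fixes f :: "complex^'k \<Rightarrow> complex^'k" and U V :: "(complex^'k) set" and d :: nat
  assumes pl: "polynomial_like f U V" and deg: "topological_degree_is f U V d" and d_gt_1: "d > 1"
begin

definition fib :: "complex^'k \<Rightarrow> (complex^'k) set" where "fib y = {x\<in>U. f x = y}"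

definition core :: "(complex^'k) set" where "core = {x\<in>U. f x \<in> closure U}"

lemma open_U: "open U" and compact_closure: "compact (closure U)" and closure_V: "closure U \<subseteq> V"
  and hol: "cholomorphic_on f U" and open_V: "open V"
  using pl by (auto simp: polynomial_like_def)

lemma compact_core: "compact core"
  using pl compact_closure closure_V unfolding polynomial_like_def core_def by blast

lemma core_U: "core \<subseteq> U" by (auto simp: core_def)

lemma core_fiber: "y \<in> closure U \<Longrightarrow> {x\<in>core. f x = y} = fib y"
  by (auto simp: core_def fib_def)

lemma fiber_sum_core:
  assumes h: "h \<in> borel_measurable lebesgue"
  shows "fiber_sum f core h \<in> borel_measurable lebesgue"
    and "(\<integral>\<^sup>+y. fiber_sum f core h y \<partial>lebesgue) \<le> (\<integral>\<^sup>+x\<in>core. h x * ennreal (jacobian f x) \<partial>lebesgue)"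
proof -
  \<comment> \<open>\<open>'k bit0\<close> has twice as many elements as \<open>'k\<close>, which is
    the real dimension of \<open>complex^'k\<close>.\<close>
  have "card (UNIV :: 'k bit0 set) = card (Basis :: (complex^'k) set)" by simp
  then obtain \<beta> :: "'k bit0 \<Rightarrow> complex^'k" where \<beta>: "bij_betw \<beta> UNIV Basis"
    using finite_same_card_bij[of "UNIV :: 'k bit0 set" "Basis :: (complex^'k) set"] by auto
  \<comment> \<open>Cut off at \<open>core\<close>, where \<open>J\<close> is continuous, the
    Jacobian becomes a weight on the whole space.\<close>
  define w where "w x = ennreal (indicator core x * jacobian f x)" for x
  have core: "core \<in> sets borel" using compact_core by (simp add: borel_compact)
  have "(\<lambda>x. indicator core x *\<^sub>R jacobian f x) \<in> borel_measurable borel"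
    using core continuous_on_subset[OF continuous_on_jacobian[OF hol open_U] core_U]
    by (rule borel_measurable_continuous_on_indicator)
  then have w: "w \<in> borel_measurable lebesgue"
    unfolding w_def by (intro measurable_completion) simp
  have D: "(f has_derivative frechet_derivative f (at x)) (at x within B)" if "x \<in> B" "B \<subseteq> core" for x B
    using cholomorphic_onD(1)[OF hol, of x] that core_U has_derivative_at_withinI by blast
  have img1: "f ` B \<in> sets lebesgue" if "B \<in> sets lebesgue" "B \<subseteq> core" for B
  proof -
    have "f differentiable_on B"
      using D[OF _ that(2)] unfolding differentiable_on_def differentiable_def by blast
    then show ?thesis by (intro differentiable_image_in_sets_lebesgue[OF that(1)]) auto
  qed
  have img2: "emeasure lebesgue (f ` B) \<le> (\<integral>\<^sup>+x\<in>B. w x \<partial>lebesgue)" if B: "B \<in> sets lebesgue" "B \<subseteq> core" for B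
  proof (rule emeasure_differentiable_image_le_euclidean[OF \<beta> B(1) D[OF _ B(2)] w])
    fix x assume x: "x \<in> B"
    then have "x \<in> U" using B core_U by auto
    then have "abs_det \<beta> (frechet_derivative f (at x)) = jacobian f x"
      by (simp add: cholomorphic_onD(3)[OF hol] abs_det_eq_cmod_det[OF \<beta>] jacobian_def)
    then show "w x = ennreal (abs_det \<beta> (frechet_derivative f (at x)))"
      using x B by (auto simp: w_def)
  qed
  have core': "core \<in> sets lebesgue" using core by simp
  note * = fiber_sum_area[OF img1 img2 w core' h]
  show "fiber_sum f core h \<in> borel_measurable lebesgue" using * by blast
  have eq: "(\<integral>\<^sup>+x\<in>core. h x * w x \<partial>lebesgue) = (\<integral>\<^sup>+x\<in>core. h x * ennreal (jacobian f x) \<partial>lebesgue)"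
    by (intro nn_integral_cong) (auto simp: w_def indicator_def)
  show "(\<integral>\<^sup>+y. fiber_sum f core h y \<partial>lebesgue) \<le> (\<integral>\<^sup>+x\<in>core. h x * ennreal (jacobian f x) \<partial>lebesgue)"
    using * unfolding eq by (rule conjunct2)
qed

section \<open>Exceptional values and the backward invariant set of generic points\<close>

definition bad :: "nat \<Rightarrow> (complex^'k) set" where
  "bad n = ((\<lambda>S. f ` (S \<inter> U)) ^^ n) {y\<in>V. \<not> (finite (fib y) \<and> card (fib y) = d)}"

text \<open>Removing all forward images of the exceptional values, not just these values, makes the
  set backward invariant: if a preimage of \<open>y\<close> lies in \<open>bad n\<close>, then
  \<open>y\<close> lies in \<open>bad (Suc n)\<close>. Hence the preimage tree of a good point
  branches into exactly \<open>d\<close> points everywhere.\<close>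

definition good :: "(complex^'k) set" where "good = closure U - (\<Union>n. bad n)"

text \<open>The degree hypothesis gives the case 0; then a differentiable map between spaces of
  equal dimension takes null sets to null sets.\<close>

lemma negligible_bad: "negligible (bad n)"
proof (induction n)
  case 0
  have "AE y in lborel. y \<notin> bad 0"
    using deg unfolding topological_degree_is_def bad_def fib_def by eventually_elim auto
  then show ?case
    by (simp add: negligible_iff_null_sets completion.null_sets_iff_AE AE_completion)
next
  case (Suc n)
  have "f differentiable_on (bad n \<inter> U)"
    unfolding differentiable_on_def differentiable_def
    using cholomorphic_onD(1)[OF hol] has_derivative_at_withinI by blast
  moreover have "negligible (bad n \<inter> U)" using Suc negligible_Int by blast
  ultimately have "negligible (f ` (bad n \<inter> U))"
    by (intro negligible_differentiable_image_negligible) auto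
  then show ?case by (simp add: bad_def)
qed

lemma negligible_Union_bad: "negligible (\<Union>n. bad n)"
  using negligible_countable_Union[of "range bad"] negligible_bad by auto

lemma good_sets [measurable]: "good \<in> sets lebesgue"
  unfolding good_def using negligible_Union_bad
  by (intro sets.Diff) (auto simp: negligible_iff_null_sets)

lemma good_closure: "good \<subseteq> closure U" by (auto simp: good_def)

lemma fib_good:
  assumes "y \<in> good"
  shows "finite (fib y)" "card (fib y) = d" "fib y \<subseteq> good" "fib y \<subseteq> core" "fib y \<noteq> {}"
proof -
  have "y \<in> V" using assms closure_V by (auto simp: good_def)
  moreover have "y \<notin> bad 0" using assms by (auto simp: good_def)
  ultimately show fin: "finite (fib y)" "card (fib y) = d" by (auto simp: bad_def)
  show "fib y \<noteq> {}" using fin d_gt_1 by auto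
  show "fib y \<subseteq> core" using assms by (auto simp: core_def fib_def good_def)
  show "fib y \<subseteq> good"
  proof
    fix v assume v: "v \<in> fib y"
    have "v \<notin> bad n" for n
    proof
      assume "v \<in> bad n"
      then have "y \<in> bad (Suc n)" using v by (auto simp: bad_def fib_def)
      then show False using assms by (auto simp: good_def)
    qed
    moreover have "v \<in> closure U" using v closure_subset by (auto simp: fib_def)
    ultimately show "v \<in> good" by (auto simp: good_def)
  qed
qed

text \<open>The last application of \<open>f\<close> is peeled off, at
  \<open>v = (f ^^ n) w\<close>, so inductions on \<open>n\<close> pass from \<open>y\<close> to its
  immediate preimages.\<close>

lemma iter_preimage_Suc:
  "iter_preimage f U (Suc n) y = (\<Union>v\<in>fib y. iter_preimage f U n v)"
  by (auto simp: iter_preimage_def fib_def less_Suc_eq)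

text \<open>True from level 1 on only: at level 0 the preimage is \<open>y\<close> itself. For a
  preimage \<open>w\<close> of positive level, \<open>f w\<close> is either \<open>y\<close> or
  again a point of \<open>U\<close>.\<close>

lemma iter_preimage_core:
  assumes "y \<in> closure U"
  shows "iter_preimage f U (Suc n) y \<subseteq> core"
proof
  fix w assume w: "w \<in> iter_preimage f U (Suc n) y"
  then have orb: "\<And>j. j < Suc n \<Longrightarrow> (f ^^ j) w \<in> U" and y: "(f ^^ Suc n) w = y"
    by (auto simp: iter_preimage_def)
  have "f w \<in> closure U"
  proof (cases n)
    case 0
    then show ?thesis using y assms by simp
  next
    case (Suc m)
    then show ?thesis using orb[of 1] closure_subset by auto
  qed
  then show "w \<in> core" using orb[of 0] by (simp add: core_def)
qed

lemma card_iter_preimage: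
  assumes "y \<in> good"
  shows "finite (iter_preimage f U n y) \<and> card (iter_preimage f U n y) = d ^ n"
  using assms
proof (induction n arbitrary: y)
  case 0
  have "iter_preimage f U 0 y = {y}" by (auto simp: iter_preimage_def)
  then show ?case by simp
next
  case (Suc n)
  have IH: "finite (iter_preimage f U n v)" "card (iter_preimage f U n v) = d ^ n" if "v \<in> fib y" for v
    using Suc.IH[of v] fib_good(3)[OF Suc.prems] that by auto
  have "card (iter_preimage f U (Suc n) y) = (\<Sum>v\<in>fib y. card (iter_preimage f U n v))"
    unfolding iter_preimage_Suc using IH fib_good(1)[OF Suc.prems]
    by (intro card_UN_disjoint) (auto simp: iter_preimage_def)
  then show ?case
    using IH fib_good[OF Suc.prems] by (simp add: iter_preimage_Suc)
qed

section \<open>Averages over iterated preimages\<close>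

text \<open>The normalised pull-back under \<open>f^n\<close> of the point mass at \<open>y\<close>,
  tested on \<phi>. Integrating it in \<open>y\<close> over \<open>good\<close> and dividing by
  \<open>vol\<close> gives the integral of \<phi> against the pulled back Lebesgue measure.\<close>

definition avg :: "(complex^'k \<Rightarrow> real) \<Rightarrow> nat \<Rightarrow> complex^'k \<Rightarrow> real" where
  "avg \<phi> n y = (\<Sum>w\<in>iter_preimage f U n y. \<phi> w) / real d ^ n"

lemma avg_0: "avg \<phi> 0 y = \<phi> y"
proof -
  have "iter_preimage f U 0 y = {y}" by (auto simp: iter_preimage_def)
  then show ?thesis by (simp add: avg_def)
qed

lemma avg_Suc:
  assumes "y \<in> good"
  shows "avg \<phi> (Suc n) y = (\<Sum>v\<in>fib y. avg \<phi> n v) / real d"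
proof -
  have "(\<Sum>w\<in>iter_preimage f U (Suc n) y. \<phi> w) = (\<Sum>v\<in>fib y. \<Sum>w\<in>iter_preimage f U n v. \<phi> w)"
    unfolding iter_preimage_Suc using fib_good[OF assms] card_iter_preimage
    by (intro sum.UNION_disjoint) (auto simp: iter_preimage_def)
  then show ?thesis by (simp add: avg_def sum_divide_distrib mult.commute)
qed

lemma avg_cong_core:
  assumes "y \<in> good" "\<And>x. x \<in> core \<Longrightarrow> \<phi> x = \<psi> x"
  shows "avg \<phi> (Suc n) y = avg \<psi> (Suc n) y"
  unfolding avg_def using iter_preimage_core[of y n] assms good_closure
  by (intro arg_cong2[where f="(/)"] sum.cong refl) auto

lemma avg_const: "y \<in> good \<Longrightarrow> avg (\<lambda>_. c) n y = c"
  using card_iter_preimage[of y n] d_gt_1 by (simp add: avg_def)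

lemma abs_avg_le:
  assumes "y \<in> good" "\<And>x. \<bar>\<phi> x\<bar> \<le> C"
  shows "\<bar>avg \<phi> n y\<bar> \<le> C"
proof -
  have "\<bar>\<Sum>w\<in>iter_preimage f U n y. \<phi> w\<bar> \<le> (\<Sum>w\<in>iter_preimage f U n y. C)"
    using assms by (intro order.trans[OF sum_abs] sum_mono) auto
  then show ?thesis
    using card_iter_preimage[OF assms(1), of n] d_gt_1
    by (simp add: avg_def abs_divide divide_le_eq mult.commute)
qed

text \<open>\<open>fiber_sum\<close> is nonnegative, so positive and negative parts of
  \<open>g\<close> are handled separately; over \<open>good\<close> the fibres are finite and the
  two sums may be subtracted.\<close>

lemma measurable_sum_fib:
  fixes g :: "complex^'k \<Rightarrow> real"
  assumes g: "g \<in> borel_measurable lebesgue"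
  shows "(\<lambda>y. indicator good y * (\<Sum>v\<in>fib y. g v)) \<in> borel_measurable lebesgue"
proof -
  have [measurable]: "fiber_sum f core (\<lambda>x. ennreal (g x)) \<in> borel_measurable lebesgue"
    "fiber_sum f core (\<lambda>x. ennreal (- g x)) \<in> borel_measurable lebesgue"
    using g by (auto intro!: fiber_sum_core(1))
  have eq: "indicator good y * (\<Sum>v\<in>fib y. g v) = indicator good y *
    (enn2real (fiber_sum f core (\<lambda>x. ennreal (g x)) y) - enn2real (fiber_sum f core (\<lambda>x. ennreal (- g x)) y))" for y
  proof (cases "y \<in> good")
    case True
    then have "{x\<in>core. f x = y} = fib y" using core_fiber good_closure by blast
    then have fs: "fiber_sum f core h y = (\<Sum>v\<in>fib y. h v)" for h
      using fiber_sum_finite[of core f y h] fib_good(1)[OF True] by simp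
    have "enn2real (fiber_sum f core (\<lambda>x. ennreal (g x)) y) - enn2real (fiber_sum f core (\<lambda>x. ennreal (- g x)) y)
      = (\<Sum>v\<in>fib y. enn2real (ennreal (g v)) - enn2real (ennreal (- g v)))"
      by (simp add: fs enn2real_sum sum_subtractf)
    also have "\<dots> = (\<Sum>v\<in>fib y. g v)"
    proof (intro sum.cong refl)
      show "enn2real (ennreal (g v)) - enn2real (ennreal (- g v)) = g v" for v
        by (cases "g v \<ge> 0") (auto simp: ennreal_neg)
    qed
    finally show ?thesis by simp
  qed simp
  show ?thesis unfolding eq by measurable
qed

lemma measurable_avg:
  assumes "\<phi> \<in> borel_measurable lebesgue"
  shows "(\<lambda>y. indicator good y * avg \<phi> n y) \<in> borel_measurable lebesgue"
proof (induction n)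
  case 0
  show ?case using assms by (simp add: avg_0)
next
  case (Suc n)
  have "indicator good y * avg \<phi> (Suc n) y
    = indicator good y * (\<Sum>v\<in>fib y. indicator good v * avg \<phi> n v) / real d" for y
  proof (cases "y \<in> good")
    case True
    then have "(\<Sum>v\<in>fib y. indicator good v * avg \<phi> n v) = (\<Sum>v\<in>fib y. avg \<phi> n v)"
      using fib_good(3)[OF True] by (intro sum.cong) (auto simp: indicator_def)
    then show ?thesis using avg_Suc[OF True] by simp
  qed simp
  then show ?case using measurable_sum_fib[OF Suc] by simp
qed

section \<open>The weighted transfer operator\<close>

text \<open>For good \<open>y\<close> this is the sum of
  \<open>exp (- (F w + F (f w) + ... + F ((f ^^ (n-1)) w)))\<close> over the \<open>n\<close>-th
  preimages \<open>w\<close> of \<open>y\<close>. The recursive form lets the area inequality act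
  once per step.\<close>

primrec weighted_count :: "(complex^'k \<Rightarrow> real) \<Rightarrow> nat \<Rightarrow> complex^'k \<Rightarrow> ennreal" where
  "weighted_count F 0 = indicator (closure U)"
| "weighted_count F (Suc n) = fiber_sum f core (\<lambda>w. ennreal (exp (- F w)) * weighted_count F n w)"

lemma measurable_weighted_count: "F \<in> borel_measurable lebesgue \<Longrightarrow> weighted_count F n \<in> borel_measurable lebesgue"
proof (induction n)
  case 0
  have "closure U \<in> sets lebesgue" by simp
  then show ?case unfolding weighted_count.simps by (rule borel_measurable_indicator)
qed (auto intro!: fiber_sum_core(1))

text \<open>The area inequality costs a factor \<open>J\<close>, which the weight
  \<open>exp (- F)\<close> absorbs on \<open>core\<close>; so no step increases the
  integral.\<close>

lemma nn_integral_weighted_count_le: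
  assumes F: "F \<in> borel_measurable lebesgue" and J: "\<And>x. x \<in> core \<Longrightarrow> jacobian f x \<le> exp (F x)"
  shows "(\<integral>\<^sup>+y. weighted_count F n y \<partial>lebesgue) \<le> emeasure lebesgue (closure U)"
proof (induction n)
  case (Suc n)
  have "(\<integral>\<^sup>+y. weighted_count F (Suc n) y \<partial>lebesgue)
      \<le> (\<integral>\<^sup>+x\<in>core. ennreal (exp (- F x)) * weighted_count F n x * ennreal (jacobian f x) \<partial>lebesgue)"
    using F by (auto intro!: fiber_sum_core(2) borel_measurable_times_ennreal measurable_weighted_count)
  also have "\<dots> \<le> (\<integral>\<^sup>+x. weighted_count F n x \<partial>lebesgue)"
  proof (intro nn_integral_mono)
    fix x
    show "ennreal (exp (- F x)) * weighted_count F n x * ennreal (jacobian f x) * indicator core x \<le> weighted_count F n x"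
    proof (cases "x \<in> core")
      case True
      have "ennreal (exp (- F x)) * weighted_count F n x * ennreal (jacobian f x) = ennreal (exp (- F x) * jacobian f x) * weighted_count F n x"
        by (simp add: ennreal_mult jacobian_nonneg mult_ac)
      also have "\<dots> \<le> 1 * weighted_count F n x"
        using J[OF True] by (intro mult_right_mono) (auto simp: exp_minus field_simps)
      finally show ?thesis using True by simp
    qed simp
  qed
  also note Suc
  finally show ?case .
qed simp

text \<open>Jensen's inequality is applied to one fibre at a time along the recursion, instead of
  once to the whole preimage tree.\<close>

lemma weighted_count_ge:
  assumes "y \<in> good"
  shows "ennreal (real d ^ n * exp (- (\<Sum>j<n. avg F (Suc j) y))) \<le> weighted_count F n y"
  using assms
proof (induction n arbitrary: y)
  case 0
  then show ?case using good_closure by (auto simp: indicator_def)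
next
  case (Suc n)
  note fg = fib_good[OF Suc.prems]
  define S where "S v = (\<Sum>j<n. avg F (Suc j) v)" for v
  have "(\<Sum>j<Suc n. avg F (Suc j) y) = (\<Sum>j<Suc n. (\<Sum>v\<in>fib y. avg F j v) / real d)"
    by (intro sum.cong refl avg_Suc Suc.prems)
  also have "\<dots> = (\<Sum>v\<in>fib y. \<Sum>j<Suc n. avg F j v) / real d"
    unfolding sum_divide_distrib[symmetric] by (subst sum.swap) simp
  also have "\<dots> = (\<Sum>v\<in>fib y. F v + S v) / real d"
    \<comment> \<open>The summand \<open>j = 0\<close> is \<open>F v\<close>; the remaining ones
      form the exponent in the induction hypothesis at \<open>v\<close>.\<close>
    by (simp only: sum.lessThan_Suc_shift avg_0 S_def)
  finally have S_Suc: "(\<Sum>j<Suc n. avg F (Suc j) y) = (\<Sum>v\<in>fib y. F v + S v) / real d" .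
  have "real d * exp (- ((\<Sum>v\<in>fib y. F v + S v) / real d)) \<le> (\<Sum>v\<in>fib y. exp (- (F v + S v)))"
    using sum_exp_ge_card_exp_average[of "fib y" "\<lambda>v. F v + S v"] fg by simp
  then have "real d ^ n * (real d * exp (- ((\<Sum>v\<in>fib y. F v + S v) / real d)))
      \<le> real d ^ n * (\<Sum>v\<in>fib y. exp (- (F v + S v)))"
    by (intro mult_left_mono) auto
  also have "\<dots> = (\<Sum>v\<in>fib y. exp (- F v) * (real d ^ n * exp (- S v)))"
    unfolding sum_distrib_left minus_add_distrib exp_add by (intro sum.cong refl) (simp add: mult_ac)
  finally have "ennreal (real d ^ Suc n * exp (- (\<Sum>j<Suc n. avg F (Suc j) y)))
      \<le> ennreal (\<Sum>v\<in>fib y. exp (- F v) * (real d ^ n * exp (- S v)))"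
    unfolding S_Suc by (intro ennreal_leI) (simp add: mult_ac)
  also have "\<dots> = (\<Sum>v\<in>fib y. ennreal (exp (- F v)) * ennreal (real d ^ n * exp (- S v)))"
    by (subst sum_ennreal[symmetric]) (auto simp: ennreal_mult)
  also have "\<dots> \<le> (\<Sum>v\<in>fib y. ennreal (exp (- F v)) * weighted_count F n v)"
    using Suc.IH fg(3) unfolding S_def by (intro sum_mono mult_left_mono) auto
  also have "\<dots> = weighted_count F (Suc n) y"
  proof -
    have "{x\<in>core. f x = y} = fib y" using core_fiber good_closure Suc.prems by blast
    then show ?thesis using fiber_sum_finite[of core f y] fg(1) by simp
  qed
  finally show ?case .
qed

abbreviation vol :: real where "vol \<equiv> measure lebesgue (closure U)"

lemma closure_lmeasurable: "closure U \<in> lmeasurable"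
  using compact_closure by (rule lmeasurable_compact)

lemma emeasure_closure: "emeasure lebesgue (closure U) = ennreal vol"
  using closure_lmeasurable by (rule emeasure_eq_measure2)

lemma integrable_good_avg:
  assumes F: "F \<in> borel_measurable lebesgue" "\<And>x. \<bar>F x\<bar> \<le> C"
  shows "integrable lebesgue (\<lambda>y. indicator good y * avg F n y)"
proof (rule Bochner_Integration.integrable_bound)
  show "integrable lebesgue (\<lambda>y. indicator (closure U) y *\<^sub>R C)"
    using closure_lmeasurable unfolding fmeasurable_def
    by (intro integrable_scaleR_left integrable_real_indicator) blast+
  show "(\<lambda>y. indicator good y * avg F n y) \<in> borel_measurable lebesgue"
    by (rule measurable_avg[OF F(1)])
  have "C \<ge> 0" using F(2)[of undefined] by linarith
  then show "AE y in lebesgue. norm (indicator good y * avg F n y) \<le> norm (indicator (closure U) y *\<^sub>R C)"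
    using abs_avg_le[OF _ F(2)] good_closure by (intro AE_I2) (auto simp: indicator_def)
qed

lemma measure_good: "measure lebesgue good = vol" "good \<in> lmeasurable"
proof -
  have "measure lebesgue (closure U - (\<Union>n. bad n)) = vol"
    using negligible_Union_bad by (intro measure_Diff_null_set) (auto simp: negligible_iff_null_sets)
  then show "measure lebesgue good = vol" by (simp add: good_def)
  show "good \<in> lmeasurable"
    using closure_lmeasurable good_closure good_sets by (rule fmeasurableI2)
qed

text \<open>Jensen's inequality once more, now for the integral over \<open>good\<close>, in the
  form \<open>1 + t \<le> exp t\<close> with \<open>t\<close> equal to \<open>n * ln d\<close> minus
  the sum of the averages. The weighted count has integral at most \<open>vol\<close>, which is
  exactly the integral of the constant 1, so nothing is lost when it cancels.\<close>

lemma sum_avg_ge: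
  assumes F: "F \<in> borel_measurable lebesgue" "\<And>x. \<bar>F x\<bar> \<le> C"
    and J: "\<And>x. x \<in> core \<Longrightarrow> jacobian f x \<le> exp (F x)"
  shows "vol * (real n * ln (real d)) \<le> (\<Sum>j<n. \<integral>y. indicator good y * avg F (Suc j) y \<partial>lebesgue)"
proof -
  let ?S = "\<lambda>y. \<Sum>j<n. indicator good y * avg F (Suc j) y"
  let ?c = "1 + real n * ln (real d)"
  let ?h = "\<lambda>y. indicator good y * ?c - ?S y"
  have intS: "integrable lebesgue ?S"
    using integrable_good_avg[OF F] by (intro Bochner_Integration.integrable_sum)
  have intg: "integrable lebesgue (\<lambda>y. indicator good y * ?c)"
    using measure_good(2) unfolding fmeasurable_def
    by (intro integrable_mult_left integrable_real_indicator) blast+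
  have "ennreal (?h y) \<le> weighted_count F n y" for y
  proof (cases "y \<in> good")
    case True
    define s where "s = (\<Sum>j<n. avg F (Suc j) y)"
    have "?h y = ?c - s" using True by (simp add: s_def)
    also have "\<dots> \<le> exp (real n * ln (real d) - s)"
      using exp_ge_add_one_self[of "real n * ln (real d) - s"] by linarith
    also have "\<dots> = real d ^ n * exp (- s)"
      using d_gt_1 by (simp add: exp_diff exp_minus field_simps exp_of_nat_mult)
    finally have "ennreal (?h y) \<le> ennreal (real d ^ n * exp (- s))" by (rule ennreal_leI)
    also have "\<dots> \<le> weighted_count F n y" unfolding s_def by (rule weighted_count_ge[OF True])
    finally show ?thesis .
  qed simp
  then have "(\<integral>\<^sup>+y. ennreal (?h y) \<partial>lebesgue) \<le> (\<integral>\<^sup>+y. weighted_count F n y \<partial>lebesgue)"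
    by (intro nn_integral_mono)
  also have "\<dots> \<le> ennreal vol"
    using nn_integral_weighted_count_le[OF F(1) J] emeasure_closure by simp
  finally have "(\<integral>y. ?h y \<partial>lebesgue) \<le> vol"
    by (rule real_integral_le_nn_integral) simp
  moreover have "(\<integral>y. ?h y \<partial>lebesgue) = (\<integral>y. indicator good y * ?c \<partial>lebesgue) - (\<integral>y. ?S y \<partial>lebesgue)"
    by (rule Bochner_Integration.integral_diff[OF intg intS])
  moreover have "(\<integral>y. ?S y \<partial>lebesgue) = (\<Sum>j<n. \<integral>y. indicator good y * avg F (Suc j) y \<partial>lebesgue)"
    by (intro Bochner_Integration.integral_sum integrable_good_avg[OF F])
  moreover have "(\<integral>y. indicator good y * ?c \<partial>lebesgue) = vol * ?c"
    using measure_good(1) by simp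
  ultimately show ?thesis by (simp add: algebra_simps)
qed

end

section \<open>The equilibrium measure\<close>

locale polynomial_like_equilibrium = polynomial_like_degree f U V d
  for f :: "complex^'k \<Rightarrow> complex^'k" and U V :: "(complex^'k) set" and d :: nat +
  fixes \<mu> :: "(complex^'k) measure"
  assumes equil: "equilibrium_measure f U V d \<mu>"
begin

sublocale prob_space \<mu> using equil by (simp add: equilibrium_measure_def)

lemma sets_mu [measurable_cong]: "sets \<mu> = sets borel"
  using equil by (simp add: equilibrium_measure_def)

text \<open>A probability measure carried by \<open>V\<close> forces \<open>V\<close> to be
  nonempty. Being open, \<open>V\<close> then contains a value that is not exceptional, and its
  \<open>d\<close> preimages show that the open set \<open>U\<close> is nonempty.\<close>

lemma vol_pos: "vol > 0"
proof -
  have "V \<noteq> {}"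
  proof
    assume "V = {}"
    moreover have "emeasure \<mu> (UNIV - V) = 0" using equil by (simp add: equilibrium_measure_def)
    moreover have "space \<mu> = UNIV" using sets_eq_imp_space_eq[OF sets_mu] by simp
    ultimately show False using emeasure_space_1 by simp
  qed
  then have "\<not> negligible V" using open_V open_not_negligible by blast
  then have "\<not> V \<subseteq> bad 0" using negligible_bad negligible_subset by blast
  then obtain y where "card (fib y) = d" by (auto simp: bad_def)
  then have "fib y \<noteq> {}" using d_gt_1 by auto
  then have "U \<noteq> {}" by (auto simp: fib_def)
  then have "\<not> negligible U" using open_U open_not_negligible by blast
  then have "\<not> negligible (closure U)" using closure_subset negligible_subset by blast
  then have "vol \<noteq> 0" using closure_lmeasurable negligible_iff_measure by blast
  then show ?thesis using measure_nonneg[of lebesgue "closure U"] by linarith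
qed

text \<open>A density that vanishes on a suitable Borel null set makes the integrands of
  the equilibrium condition Borel measurable.\<close>

lemma avg_tendsto:
  assumes \<phi>: "continuous_on UNIV \<phi>" and supp: "{x. \<phi> x \<noteq> 0} \<subseteq> U"
  shows "(\<lambda>n. (\<integral>y. indicator good y * avg \<phi> n y \<partial>lebesgue) / vol) \<longlonglongrightarrow> (\<integral>x. \<phi> x \<partial>\<mu>)"
proof -
  have "\<phi> \<in> borel_measurable lebesgue"
    using \<phi> by (intro measurable_completion) (simp add: borel_measurable_continuous_onI)
  then have "\<exists>b\<in>borel_measurable lborel. AE y in lborel. indicator good y * avg \<phi> n y = b y" for n
    by (intro completion_ex_borel_measurable_real measurable_avg)
  then obtain b where b: "\<And>n. b n \<in> borel_measurable lborel"
    "\<And>n. AE y in lborel. indicator good y * avg \<phi> n y = b n y"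
    by metis
  have "AE y in lebesgue. y \<notin> (\<Union>n. bad n)"
    using negligible_Union_bad by (intro AE_not_in) (simp add: negligible_iff_null_sets)
  then have "AE y in lborel. y \<notin> (\<Union>n. bad n)" by (simp add: AE_completion_iff)
  moreover have "AE y in lborel. \<forall>n. indicator good y * avg \<phi> n y = b n y"
    using b(2) by (simp add: AE_all_countable)
  \<comment> \<open>The density must not depend on \<open>n\<close>, so a single null set has to
    serve all levels at once.\<close>
  ultimately have "AE y in lborel. y \<notin> (\<Union>n. bad n) \<and> (\<forall>n. indicator good y * avg \<phi> n y = b n y)"
    by eventually_elim auto
  then obtain N where N: "N \<in> null_sets lborel"
    "{y \<in> space lborel. \<not> (y \<notin> (\<Union>n. bad n) \<and> (\<forall>n. indicator good y * avg \<phi> n y = b n y))} \<subseteq> N"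
    unfolding eventually_ae_filter by auto
  then have N': "y \<notin> (\<Union>n. bad n)" "indicator good y * avg \<phi> n y = b n y" if "y \<notin> N" for y n
    using that by auto
  have Nb: "N \<in> sets borel" using N(1) by auto
  define g :: "complex^'k \<Rightarrow> real" where "g y = indicator (closure U - N) y / vol" for y
  have gN: "y \<in> closure U - N \<Longrightarrow> y \<in> good" for y using N' by (auto simp: good_def)
  have AEN: "AE y in lebesgue. y \<notin> N" using AE_completion[OF AE_not_in[OF N(1)]] .
  have "closure U \<in> fmeasurable lborel"
    using emeasure_bounded_finite[OF compact_imp_bounded[OF compact_closure]]
    by (intro fmeasurableI) auto
  then have fin: "closure U - N \<in> fmeasurable lborel"
    by (rule fmeasurableI2) (use Nb in auto)
  have "closure U \<in> sets lborel" by simp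
  then have meas: "measure lborel (closure U - N) = vol"
    using measure_Diff_null_set[OF _ N(1)] by simp
  have int_g: "integrable lborel g" "(\<integral>y. g y \<partial>lborel) = 1"
    using fin meas vol_pos unfolding g_def fmeasurable_def by auto
  have "(\<lambda>n. (\<integral>y. g y * (\<Sum>w\<in>iter_preimage f U n y. \<phi> w) \<partial>lborel) / real d ^ n) \<longlonglongrightarrow> (\<integral>x. \<phi> x \<partial>\<mu>)"
  proof -
    have "closure {x. \<phi> x \<noteq> 0} \<subseteq> closure U" using supp by (rule closure_mono)
    then have "compact (closure {x. \<phi> x \<noteq> 0})" "closure {x. \<phi> x \<noteq> 0} \<subseteq> V"
      using compact_closure closure_V closed_closure compact_Int_closed[of "closure U" "closure {x. \<phi> x \<noteq> 0}"]
      by (auto simp: Int_absorb1)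
    moreover have "\<forall>y. g y \<ge> 0" "\<forall>y. y \<notin> V \<longrightarrow> g y = 0"
      using closure_V vol_pos by (auto simp: g_def indicator_def)
    ultimately show ?thesis
      using equil \<phi> int_g unfolding equilibrium_measure_def by blast
  qed
  moreover have "(\<integral>y. g y * (\<Sum>w\<in>iter_preimage f U n y. \<phi> w) \<partial>lborel) / real d ^ n
      = (\<integral>y. indicator good y * avg \<phi> n y \<partial>lebesgue) / vol" for n
  proof -
    have gb: "g y * (\<Sum>w\<in>iter_preimage f U n y. \<phi> w) / real d ^ n = g y * b n y" for y
    proof (cases "y \<in> closure U - N")
      case True
      then have "b n y = avg \<phi> n y" using N'(2)[of y n] gN[OF True] by simp
      then show ?thesis by (simp add: avg_def)
    qed (simp add: g_def)
    have "(\<integral>y. g y * (\<Sum>w\<in>iter_preimage f U n y. \<phi> w) \<partial>lborel) / real d ^ n = (\<integral>y. g y * b n y \<partial>lborel)"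
      unfolding gb[symmetric] by simp
    also have "\<dots> = (\<integral>y. g y * b n y \<partial>lebesgue)"
      using borel_measurable_integrable[OF int_g(1)] b(1)
      by (intro integral_completion[symmetric] borel_measurable_times)
    also have "\<dots> = (\<integral>y. indicator good y * avg \<phi> n y / vol \<partial>lebesgue)"
    proof (rule integral_cong_AE)
      show "(\<lambda>y. g y * b n y) \<in> borel_measurable lebesgue"
        using borel_measurable_integrable[OF int_g(1)] b(1)
        by (intro measurable_completion borel_measurable_times)
      show "(\<lambda>y. indicator good y * avg \<phi> n y / vol) \<in> borel_measurable lebesgue"
        using measurable_avg[OF \<open>\<phi> \<in> borel_measurable lebesgue\<close>] by (intro borel_measurable_divide) auto
      show "AE y in lebesgue. g y * b n y = indicator good y * avg \<phi> n y / vol"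
        using AEN
      proof eventually_elim
        case (elim y)
        then show ?case
          using N'(2)[OF elim, of n, symmetric] gN[of y] good_closure by (auto simp: g_def indicator_def)
      qed
    qed
    finally show ?thesis by simp
  qed
  ultimately show ?thesis by simp
qed

text \<open>Multiplication by \<open>cut\<close> turns a continuous function into an admissible test
  function without changing it on \<open>core\<close>, where all preimages of positive level
  lie.\<close>

lemma cutoff_exists:
  obtains cut :: "complex^'k \<Rightarrow> real" where "continuous_on UNIV cut" "\<And>x. 0 \<le> cut x \<and> cut x \<le> 1"
    "\<And>x. cut x = 1 \<longleftrightarrow> x \<in> core" "\<And>x. cut x = 0 \<longleftrightarrow> x \<notin> U"
proof -
  have "closed core" using compact_core compact_imp_closed by blast
  moreover have "closed (- U)" using open_U by auto
  moreover have "core \<inter> - U = {}" using core_U by auto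
  ultimately obtain cut :: "complex^'k \<Rightarrow> real" where "continuous_on UNIV cut"
    "\<And>x. cut x \<in> closed_segment 1 0" "\<And>x. cut x = 1 \<longleftrightarrow> x \<in> core" "\<And>x. cut x = 0 \<longleftrightarrow> x \<in> - U"
    using Urysohn_strong[of core "- U" "1::real" 0] by auto
  then show ?thesis using that by (auto simp: closed_segment_eq_real_ivl)
qed

text \<open>From level 1 on the averages of \<open>cut\<close> equal 1, so its \<mu>-integral is 1;
  as \<open>cut \<le> 1\<close> with equality on \<open>core\<close> only, the rest is null.\<close>

lemma AE_core: "AE x in \<mu>. x \<in> core"
proof -
  obtain cut :: "complex^'k \<Rightarrow> real" where cut: "continuous_on UNIV cut" "\<And>x. 0 \<le> cut x \<and> cut x \<le> 1"
    "\<And>x. cut x = 1 \<longleftrightarrow> x \<in> core" "\<And>x. cut x = 0 \<longleftrightarrow> x \<notin> U"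
    using cutoff_exists by blast
  have [measurable]: "cut \<in> borel_measurable borel" using cut(1) by (rule borel_measurable_continuous_onI)
  have "(\<lambda>n. (\<integral>y. indicator good y * avg cut n y \<partial>lebesgue) / vol) \<longlonglongrightarrow> (\<integral>x. cut x \<partial>\<mu>)"
    using cut by (intro avg_tendsto) auto
  then have "(\<lambda>n. (\<integral>y. indicator good y * avg cut (Suc n) y \<partial>lebesgue) / vol) \<longlonglongrightarrow> (\<integral>x. cut x \<partial>\<mu>)"
    by (rule LIMSEQ_Suc)
  moreover have "(\<integral>y. indicator good y * avg cut (Suc n) y \<partial>lebesgue) / vol = 1" for n
  proof -
    have *: "indicator good y * avg cut (Suc n) y = indicator good y" for y
      using avg_cong_core[of y cut "\<lambda>_. 1" n] avg_const[of y 1 "Suc n"] cut(3) by (cases "y \<in> good") auto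
    show ?thesis unfolding * using measure_good(1) vol_pos by simp
  qed
  ultimately have "(\<integral>x. cut x \<partial>\<mu>) = 1"
    by (simp add: LIMSEQ_const_iff)
  moreover have int: "integrable \<mu> cut"
    using cut(2) by (intro integrable_const_bound[where B=1]) auto
  ultimately have "(\<integral>x. 1 - cut x \<partial>\<mu>) = 0"
    by (simp add: prob_space)
  then have "AE x in \<mu>. 1 - cut x = 0"
    using cut(2) int by (subst (asm) integral_nonneg_eq_0_iff_AE) auto
  then show ?thesis by eventually_elim (use cut(3) in force)
qed

text \<open>\<open>F\<close> itself need not have compact support in \<open>V\<close>, so
  convergence is applied to \<open>cut * F\<close>. This alters neither the averages of positive
  level nor, by \<open>AE_core\<close>, the \<mu>-integral.\<close>

lemma integral_log_ge:
  assumes F: "continuous_on UNIV F" "\<And>x. \<bar>F x\<bar> \<le> C"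
    and J: "\<And>x. x \<in> core \<Longrightarrow> jacobian f x \<le> exp (F x)"
  shows "ln (real d) \<le> (\<integral>x. F x \<partial>\<mu>)"
proof -
  obtain cut :: "complex^'k \<Rightarrow> real" where cut: "continuous_on UNIV cut" "\<And>x. 0 \<le> cut x \<and> cut x \<le> 1"
    "\<And>x. cut x = 1 \<longleftrightarrow> x \<in> core" "\<And>x. cut x = 0 \<longleftrightarrow> x \<notin> U"
    using cutoff_exists by blast
  have [measurable]: "cut \<in> borel_measurable borel" "F \<in> borel_measurable borel"
    using cut(1) F(1) by (auto intro: borel_measurable_continuous_onI)
  have FL: "F \<in> borel_measurable lebesgue" by (intro measurable_completion) simp
  let ?E = "\<lambda>n. (\<integral>y. indicator good y * avg F (Suc n) y \<partial>lebesgue) / vol"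
  have "(\<lambda>n. (\<integral>y. indicator good y * avg (\<lambda>x. cut x * F x) n y \<partial>lebesgue) / vol) \<longlonglongrightarrow> (\<integral>x. cut x * F x \<partial>\<mu>)"
    using cut F by (intro avg_tendsto continuous_intros) auto
  then have "(\<lambda>n. (\<integral>y. indicator good y * avg (\<lambda>x. cut x * F x) (Suc n) y \<partial>lebesgue) / vol) \<longlonglongrightarrow> (\<integral>x. cut x * F x \<partial>\<mu>)"
    by (rule LIMSEQ_Suc)
  moreover have "indicator good y * avg (\<lambda>x. cut x * F x) (Suc n) y = indicator good y * avg F (Suc n) y" for n y
    using avg_cong_core[of y "\<lambda>x. cut x * F x" F n] cut(3) by (cases "y \<in> good") auto
  moreover have "(\<integral>x. cut x * F x \<partial>\<mu>) = (\<integral>x. F x \<partial>\<mu>)"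
    using AE_core cut(3) by (intro integral_cong_AE) (auto elim!: eventually_mono)
  ultimately have "?E \<longlonglongrightarrow> (\<integral>x. F x \<partial>\<mu>)" by simp
  moreover have "real n * ln (real d) \<le> (\<Sum>j<n. ?E j)" for n
    using sum_avg_ge[OF FL F(2) J, of n] vol_pos
    by (simp add: sum_divide_distrib[symmetric] pos_le_divide_eq mult.commute)
  ultimately show ?thesis by (rule limit_ge_of_partial_sums_ge)
qed

text \<open>Truncation from below makes the logarithm continuous and bounded on the compact
  \<open>core\<close>, and keeps it a majorant of \<open>log J\<close>; Tietze's theorem extends it
  to the whole space with the same bound.\<close>

lemma integral_log_max_jacobian_ge:
  fixes M :: nat
  shows "ln (real d) \<le> (\<integral>x. indicator core x * ln (max (jacobian f x) (exp (- real M))) \<partial>\<mu>)"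
proof -
  define L where "L x = ln (max (jacobian f x) (exp (- real M)))" for x
  have pos: "max (jacobian f x) (exp (- real M)) > 0" for x by (simp add: less_max_iff_disj)
  have cont: "continuous_on core L"
    unfolding L_def using continuous_on_subset[OF continuous_on_jacobian[OF hol open_U] core_U] pos
    by (intro continuous_intros ballI less_imp_neq[symmetric]) auto
  then have "bounded (L ` core)" using compact_core compact_continuous_image compact_imp_bounded by blast
  then obtain C where C: "C > 0" "\<And>x. x \<in> core \<Longrightarrow> norm (L x) \<le> C"
    unfolding bounded_pos by auto
  obtain F where F: "continuous_on UNIV F" "\<And>x. x \<in> core \<Longrightarrow> F x = L x" "\<And>x. x \<in> UNIV \<Longrightarrow> norm (F x) \<le> C"
    using Tietze[OF cont, of UNIV C] C compact_core compact_imp_closed by auto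
  have "jacobian f x \<le> exp (F x)" if "x \<in> core" for x
    using pos[of x] that by (simp add: F(2) L_def)
  then have "ln (real d) \<le> (\<integral>x. F x \<partial>\<mu>)"
    using F by (intro integral_log_ge) auto
  also have "\<dots> = (\<integral>x. indicator core x * L x \<partial>\<mu>)"
  proof (rule integral_cong_AE)
    show "F \<in> borel_measurable \<mu>"
      using F(1) borel_measurable_continuous_onI measurable_cong_sets[OF sets_mu refl] by blast
    have "(\<lambda>x. indicator core x *\<^sub>R L x) \<in> borel_measurable borel"
      using compact_core cont by (intro borel_measurable_continuous_on_indicator) (auto simp: borel_compact)
    then show "(\<lambda>x. indicator core x * L x) \<in> borel_measurable \<mu>"
      using measurable_cong_sets[OF sets_mu refl] by auto
    show "AE x in \<mu>. F x = indicator core x * L x"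
      using AE_core by eventually_elim (simp add: F(2))
  qed
  finally show ?thesis by (simp add: L_def)
qed

end

section \<open>Removal of the truncation\<close>

context polynomial_like_equilibrium
begin

text \<open>The gaps between an upper bound \<open>C\<close> and the truncated logarithms are
  nonnegative and increase with \<open>M\<close>, so their supremum \<open>S\<close> has integral at
  most \<open>C - ln d\<close>. At zeros of \<open>J\<close> in \<open>core\<close> it is infinite,
  hence these are null; elsewhere it dominates \<open>C - ln J\<close>. Positivity has to come
  first: \<open>ln\<close> is total and takes a real value at 0, so a finite integral of
  \<open>ln J\<close> alone would say nothing about the critical set.\<close>

lemma AE_jacobian_pos: "AE x in \<mu>. jacobian f x > 0"
  and integrable_ln_jacobian: "integrable \<mu> (\<lambda>x. ln (jacobian f x))"
  and integral_ln_jacobian_ge: "ln (real d) \<le> (\<integral>x. ln (jacobian f x) \<partial>\<mu>)"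
proof -
  have [measurable]: "jacobian f \<in> borel_measurable borel" by (rule borel_measurable_jacobian)
  have [measurable]: "core \<in> sets borel" using compact_core by (simp add: borel_compact)
  have "bounded (jacobian f ` core)"
    using compact_core continuous_on_subset[OF continuous_on_jacobian[OF hol open_U] core_U]
    by (intro compact_imp_bounded compact_continuous_image)
  then obtain B where B: "B > 0" "\<And>x. x \<in> core \<Longrightarrow> norm (jacobian f x) \<le> B"
    unfolding bounded_pos by auto
  \<comment> \<open>The maximum with 1 makes \<open>C\<close> nonnegative, so that it also bounds
    the truncation level \<open>- M\<close> for every \<open>M\<close>.\<close>
  define C where "C = ln (max B 1)"
  have expC: "exp C = max B 1" using B(1) by (simp add: C_def)
  have C0: "C \<ge> 0" by (simp add: C_def)
  define L where "L M x = ln (max (jacobian f x) (exp (- real M)))" for M x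
  have pos: "max (jacobian f x) (exp (- real M)) > 0" for M x by (simp add: less_max_iff_disj)
  have L_lower: "- real M \<le> L M x" for M x
    using pos[of x M] by (simp add: L_def ln_ge_iff)
  have L_upper: "L M x \<le> C" if "x \<in> core" for M x
  proof -
    have "jacobian f x \<le> exp C" using B(2)[OF that] jacobian_nonneg[of f x] by (simp add: expC le_max_iff_disj)
    moreover have "exp (- real M) \<le> exp C" using C0 by simp
    ultimately have "max (jacobian f x) (exp (- real M)) \<le> exp C" by simp
    then show ?thesis using pos[of x M] unfolding L_def by (metis exp_gt_zero ln_exp ln_le_cancel_iff)
  qed
  have L_meas [measurable]: "L M \<in> borel_measurable borel" for M
    unfolding L_def by measurable
  define h where "h M x = indicator core x * (C - L M x)" for M x
  have h_nonneg: "h M x \<ge> 0" for M x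
    using L_upper by (simp add: h_def indicator_def)
  have h_meas [measurable]: "h M \<in> borel_measurable \<mu>" for M
    unfolding h_def by measurable
  have coreae: "AE x in \<mu>. indicator core x = (1::real)"
    using AE_core by eventually_elim simp
  have intL: "integrable \<mu> (\<lambda>x. indicator core x * L M x)" for M
  proof (rule integrable_const_bound[where B="real M + C"])
    have "norm (indicator core x * L M x) \<le> real M + C" for x
      using L_lower[of M x] L_upper[of x M] C0 by (cases "x \<in> core") auto
    then show "AE x in \<mu>. norm (indicator core x * L M x) \<le> real M + C" by simp
  qed measurable
  have int_h: "(\<integral>\<^sup>+x. ennreal (h M x) \<partial>\<mu>) \<le> ennreal (C - ln (real d))" for M
  proof -
    have intC: "integrable \<mu> (\<lambda>x. indicator core x * C)"
      by (intro integrable_const_bound[where B=C]) (use C0 in \<open>auto simp: indicator_def\<close>)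
    have hd: "h M = (\<lambda>x. indicator core x * C - indicator core x * L M x)"
      by (auto simp: h_def fun_eq_iff algebra_simps)
    have "(\<integral>x. indicator core x * C \<partial>\<mu>) = (\<integral>x. C \<partial>\<mu>)"
      using coreae by (intro integral_cong_AE) (auto elim!: eventually_mono)
    then have "(\<integral>x. h M x \<partial>\<mu>) = C - (\<integral>x. indicator core x * L M x \<partial>\<mu>)"
      unfolding hd using intC intL by (simp add: prob_space)
    also have "\<dots> \<le> C - ln (real d)"
      using integral_log_max_jacobian_ge[of M] by (simp add: L_def)
    finally have "(\<integral>x. h M x \<partial>\<mu>) \<le> C - ln (real d)" .
    moreover have "integrable \<mu> (h M)" unfolding hd using intC intL by simp
    ultimately show ?thesis
      using h_nonneg by (subst nn_integral_eq_integral) (auto intro: ennreal_leI)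
  qed
  have Cd: "0 \<le> C - ln (real d)"
  proof -
    have "(\<integral>x. indicator core x * L 0 x \<partial>\<mu>) \<le> (\<integral>x. C \<partial>\<mu>)"
      using L_upper C0 by (intro integral_mono intL) (auto simp: indicator_def)
    then show ?thesis
      using integral_log_max_jacobian_ge[of 0] by (simp add: L_def prob_space)
  qed
  define S where "S x = (SUP M. ennreal (h M x))" for x
  have inc: "incseq (\<lambda>M x. ennreal (h M x))"
  proof (intro incseq_SucI le_funI ennreal_leI)
    fix M x
    have "exp (- real (Suc M)) \<le> exp (- real M)" by simp
    then have "max (jacobian f x) (exp (- real (Suc M))) \<le> max (jacobian f x) (exp (- real M))"
      by (intro max.mono) auto
    then have "L (Suc M) x \<le> L M x"
      unfolding L_def using pos by (intro ln_mono)
    then show "h M x \<le> h (Suc M) x" by (simp add: h_def indicator_def)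
  qed
  have "(\<integral>\<^sup>+x. S x \<partial>\<mu>) = (SUP M. \<integral>\<^sup>+x. ennreal (h M x) \<partial>\<mu>)"
    unfolding S_def by (intro nn_integral_monotone_convergence_SUP[OF inc]) measurable
  also have "\<dots> \<le> ennreal (C - ln (real d))" by (intro SUP_least int_h)
  finally have int_S: "(\<integral>\<^sup>+x. S x \<partial>\<mu>) \<le> ennreal (C - ln (real d))" .
  then have "(\<integral>\<^sup>+x. S x \<partial>\<mu>) \<noteq> \<infinity>" by (auto simp: top_unique)
  then have S_fin: "AE x in \<mu>. S x \<noteq> \<infinity>"
    by (intro nn_integral_PInf_AE) (auto simp: S_def)
  have S_top: "S x = \<infinity>" if x: "x \<in> core" "jacobian f x = 0" for x
  proof -
    have "h M x = C + real M" for M using x by (simp add: h_def L_def max_absorb2)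
    then have "of_nat M \<le> S x" for M
      unfolding S_def using C0
      by (intro SUP_upper2[of M]) (auto simp: ennreal_of_nat_eq_real_of_nat intro!: ennreal_leI)
    then have "(SUP M. of_nat M :: ennreal) \<le> S x" by (intro SUP_least)
    then show ?thesis by (simp add: ennreal_SUP_of_nat_eq_top top_unique)
  qed
  show pos_AE: "AE x in \<mu>. jacobian f x > 0"
    using AE_core S_fin by eventually_elim (metis S_top jacobian_nonneg order_le_less)
  define G where "G x = C - ln (jacobian f x)" for x
  have [measurable]: "G \<in> borel_measurable \<mu>" unfolding G_def by measurable
  have G: "AE x in \<mu>. 0 \<le> G x \<and> ennreal (G x) \<le> S x"
    using AE_core pos_AE
  proof eventually_elim
    case (elim x)
    \<comment> \<open>For such \<open>M\<close> the truncation is inactive at \<open>x\<close>, so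
      \<open>G x\<close> is one of the terms of the supremum.\<close>
    obtain M :: nat where "- ln (jacobian f x) \<le> real M" using real_arch_simple by blast
    then have "exp (- real M) \<le> jacobian f x"
      using elim by (metis exp_le_cancel_iff exp_ln minus_le_iff)
    then have "h M x = G x" using elim by (simp add: h_def L_def G_def max_absorb1)
    then show ?case
      using h_nonneg[of M x] unfolding S_def by (auto intro: SUP_upper2[of M])
  qed
  have "(\<integral>\<^sup>+x. ennreal (G x) \<partial>\<mu>) \<le> (\<integral>\<^sup>+x. S x \<partial>\<mu>)"
    using G by (intro nn_integral_mono_AE) (auto elim: eventually_mono)
  with int_S have nn_G: "(\<integral>\<^sup>+x. ennreal (G x) \<partial>\<mu>) \<le> ennreal (C - ln (real d))" by (rule order.trans[rotated])
  have int_G: "integrable \<mu> G"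
  proof (rule integrableI_nonneg)
    show "AE x in \<mu>. 0 \<le> G x" using G by eventually_elim simp
    show "(\<integral>\<^sup>+x. ennreal (G x) \<partial>\<mu>) < \<infinity>" using nn_G by (rule le_less_trans) simp
  qed measurable
  have lnJ: "(\<lambda>x. ln (jacobian f x)) = (\<lambda>x. C - G x)" by (simp add: G_def fun_eq_iff)
  show "integrable \<mu> (\<lambda>x. ln (jacobian f x))"
    unfolding lnJ using int_G by simp
  have "(\<integral>x. G x \<partial>\<mu>) \<le> C - ln (real d)"
    using nn_G Cd by (rule real_integral_le_nn_integral)
  then show "ln (real d) \<le> (\<integral>x. ln (jacobian f x) \<partial>\<mu>)"
    unfolding lnJ using int_G by (simp add: prob_space)
qed

end

theorem theorem2p2p6:
  fixes f :: "complex^'k \<Rightarrow> complex^'k" and U V :: "(complex^'k) set"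
    and d :: nat and \<mu> :: "(complex^'k) measure"
  assumes "polynomial_like f U V"
    and "topological_degree_is f U V d"
    and "d > 1"
    and "equilibrium_measure f U V d \<mu>"
  shows "(AE x in \<mu>. jacobian f x > 0)
       \<and> integrable \<mu> (\<lambda>x. ln (jacobian f x))
       \<and> ln (real d) \<le> (\<integral>x. ln (jacobian f x) \<partial>\<mu>)
       \<and> emeasure \<mu> {x\<in>U. jacobian f x = 0} = 0"
proof -
  interpret polynomial_like_equilibrium f U V d \<mu>
    using assms by unfold_locales
  have [measurable]: "jacobian f \<in> borel_measurable borel" by (rule borel_measurable_jacobian)
  have "U \<in> sets borel" using open_U by simp
  then have "{x\<in>U. jacobian f x = 0} \<in> sets \<mu>" by measurable
  moreover have "AE x in \<mu>. x \<notin> {x\<in>U. jacobian f x = 0}"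
    using AE_jacobian_pos by eventually_elim simp
  ultimately have "emeasure \<mu> {x\<in>U. jacobian f x = 0} = 0"
    by (simp add: AE_iff_null_sets null_setsD1)
  then show ?thesis
    using AE_jacobian_pos integrable_ln_jacobian integral_ln_jacobian_ge by blast
qed

end
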